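(* Let $i,j$ be real numbers with $0<j\le i<1$ and $i+j=1$. Let $a,b\in\mathbb{R}$ and $f(x)=ax+b$, and suppose there exists $\epsilon>0$ such that $$\liminf_{q\to\infty} q^{\frac{1}{j}-\epsilon}\max\{\|qa\|,\|qb\|\}>0.$$ Then for every $\boldsymbol\theta=(\gamma,\delta)\in\mathbb{R}^2$, the set $\mathrm{Bad}^f_{\boldsymbol\theta}(i,j):=\{x\in\mathbb{R}:(x,ax+b)\in\mathrm{Bad}_{\boldsymbol\theta}(i,j)\}$ is a $1/2$-winning subset of $\mathbb{R}$.
   Context: For $t\in\mathbb{R}$, $\|t\|$ denotes the distance from $t$ to the nearest integer. For $\boldsymbol\theta=(\gamma,\delta)\in\mathbb{R}^2$, $\mathrm{Bad}_{\boldsymbol\theta}(i,j)$ is the set of $(x,y)\in\mathbb{R}^2$ for which there is $c(x,y)>0$ with $\max\{\|qx-\gamma\|^{1/i},\|qy-\delta\|^{1/j}\}>c(x,y)\,q^{-1}$ for all $q\in\mathbb{N}$. Schmidt's $(\alpha,\beta)$-game on $\mathbb{R}$: for $0<\alpha,\beta<1$, player B chooses a closed interval $B_0$; then A chooses a closed interval $A_0\subset B_0$ of length $\alpha|B_0|$; then B chooses a closed interval $B_1\subset A_0$ of length $\beta|A_0|$, and so on alternately. A set $X\subset\mathbb{R}$ is $(\alpha,\beta)$-winning if A can play so that the unique point of $\bigcap_n B_n$ lies in $X$ regardless of how B plays; it is $\alpha$-winning if it is $(\alpha,\beta)$-winning for every $\beta\in(0,1)$. *)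

theory Defs
  imports "HOL-Analysis.Analysis"
begin

definition dist_nearest_int :: "real \<Rightarrow> real" where
  "dist_nearest_int t = \<bar>t - of_int (round t)\<bar>"

definition Bad :: "real \<times> real \<Rightarrow> real \<Rightarrow> real \<Rightarrow> (real \<times> real) set" where
  "Bad = (\<lambda>(\<gamma>, \<delta>) i j. {(x, y). \<exists>c>0. \<forall>q::nat. q \<ge> 1 \<longrightarrow>
     max (dist_nearest_int (real q * x - \<gamma>) powr (1 / i))
         (dist_nearest_int (real q * y - \<delta>) powr (1 / j)) > c * inverse (real q)})"

definition Bad_fun :: "(real \<Rightarrow> real) \<Rightarrow> real \<times> real \<Rightarrow> real \<Rightarrow> real \<Rightarrow> real set" where
  "Bad_fun f \<theta> i j = {x. (x, f x) \<in> Bad \<theta> i j}"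

(* Intervals in Schmidt's game have positive length. *)
definition closed_interval :: "real set \<Rightarrow> bool" where
  "closed_interval I \<longleftrightarrow> (\<exists>l u. l < u \<and> I = {l..u})"

definition legal_move :: "real \<Rightarrow> real set \<Rightarrow> real set \<Rightarrow> bool" where
  "legal_move \<rho> I J \<longleftrightarrow>
     closed_interval J \<and> J \<subseteq> I \<and> measure lborel J = \<rho> * measure lborel I"

(* A strategy \<sigma> for player A maps the list [B 0, ..., B n] of B's moves so far to A's reply.
   A's earlier replies are determined by \<sigma>, so this list carries the full history. As long
   as B has played legally, \<sigma> must reply legally; if B plays legally forever, then
   the point common to all B n must belong to X. *)
definition schmidt_winning :: "real \<Rightarrow> real \<Rightarrow> real set \<Rightarrow> bool" where
  "schmidt_winning \<alpha> \<beta> X \<longleftrightarrow>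
     (\<exists>\<sigma> :: real set list \<Rightarrow> real set. \<forall>B :: nat \<Rightarrow> real set.
        let A = (\<lambda>n. \<sigma> (map B [0..<Suc n])) in
        closed_interval (B 0) \<longrightarrow>
          (\<forall>n. (\<forall>k<n. legal_move \<beta> (A k) (B (Suc k))) \<longrightarrow> legal_move \<alpha> (B n) (A n)) \<and>
          ((\<forall>n. legal_move \<beta> (A n) (B (Suc n))) \<longrightarrow> (\<exists>x\<in>X. (\<Inter>n. B n) = {x})))"

definition schmidt_alpha_winning :: "real \<Rightarrow> real set \<Rightarrow> bool" where
  "schmidt_alpha_winning \<alpha> X \<longleftrightarrow> (\<forall>\<beta>. 0 < \<beta> \<and> \<beta> < 1 \<longrightarrow> schmidt_winning \<alpha> \<beta> X)"

end

theory Submission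
  imports Defs
begin

text \<open>
  Write \<open>g\<^sub>t u\<^sub>x\<close> for the usual flow on lattices in three-space, with \<open>t\<close> measured multiplicatively, so that an interval
  of length \<open>t powr (- 1 - i)\<close> corresponds to time \<open>t\<close>. A is to avoid three kinds of obstacles:
  rational points \<open>(p1 / q, p2 / q)\<close> near the line \<open>y = a x + b\<close>, shifted points
  \<open>((p1 + \<gamma>) / q, (p2 + \<delta>) / q)\<close> near it, and rational lines \<open>A x + B y + C = 0\<close> close to it; each
  forbids a small interval around a centre. Every obstacle is announced long before its interval becomes
  comparable to the current one. Two obstacles of the same class announced simultaneously
  would produce a short vector of the lattice or of its dual: the cross product of two points is a line, that of two lines
  is a point, and the difference of two shifted points is a point. Such short vectors have been avoided
  earlier, so each class contributes at most one centre per round. The Diophantine condition on \<open>(a, b)\<close>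
  forces the line obstacles to be so small that they can be announced early enough. Finally, A removes each centre of class \<open>k\<close>
  within \<open>k + 9\<close> rounds by always choosing the half of smaller potential.
\<close>

section \<open>Avoiding points in Schmidt's game\<close>

lemma closed_intervalE:
  assumes "closed_interval J"
  obtains l u where "l < u" "J = {l..u}" "Inf J = l" "Sup J = u" "measure lborel J = u - l"
  using assms unfolding closed_interval_def by (auto simp:)

text \<open>
  The potential of a set \<open>S\<close> in round \<open>p\<close>. The point \<open>y m k\<close> has to be removed by round \<open>m + k + 9\<close>, and a half
  loses a factor \<open>1/2 < 3/4\<close> in each round; \<open>9\<close> is the least exponent with \<open>12 * (3/4) ^ 9 < 1\<close>.
\<close>

definition weight :: "(nat \<Rightarrow> nat \<Rightarrow> real) \<Rightarrow> nat \<Rightarrow> real set \<Rightarrow> real" where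
  "weight y p S = (\<Sum>m\<le>p. \<Sum>k. (3/4) ^ (m + k) * indicator S (y m k))"

lemma summable_weight: "summable (\<lambda>k. (3/4 :: real) ^ (m + k) * indicator S (y m k))"
proof (rule summable_comparison_test')
  show "summable (\<lambda>k. (3/4 :: real) ^ m * (3/4) ^ k)"
    by (intro summable_mult summable_geometric) auto
  show "norm ((3/4 :: real) ^ (m + k) * indicator S (y m k)) \<le> (3/4) ^ m * (3/4) ^ k" if "k \<ge> 0" for k
    by (auto simp: indicator_def power_add)
qed

lemma suminf_weight_le: "(\<Sum>k. (3/4 :: real) ^ (m + k) * indicator S (y m k)) \<le> 4 * (3/4) ^ m"
proof -
  have s: "(\<lambda>k. (3/4 :: real) ^ m * (3/4) ^ k) sums ((3/4) ^ m * (1 / (1 - 3/4)))"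
    by (intro sums_mult geometric_sums) auto
  have "(\<Sum>k. (3/4 :: real) ^ (m + k) * indicator S (y m k)) \<le> (\<Sum>k. (3/4 :: real) ^ m * (3/4) ^ k)"
    by (intro suminf_le summable_weight sums_summable[OF s]) (auto simp: indicator_def power_add)
  also have "\<dots> = (3/4) ^ m * (1 / (1 - 3/4))" using s by (rule sums_unique[symmetric])
  finally show ?thesis by simp
qed

lemma weight_mono: "S \<subseteq> S' \<Longrightarrow> weight y p S \<le> weight y p S'"
  unfolding weight_def
  by (intro sum_mono suminf_le summable_weight mult_left_mono) (auto simp: indicator_def)

lemma weight_disjoint:
  assumes "S \<inter> S' = {}" "S \<union> S' \<subseteq> U"
  shows "weight y p S + weight y p S' \<le> weight y p U"
proof -
  have "weight y p S + weight y p S' =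
      (\<Sum>m\<le>p. \<Sum>k. (3/4) ^ (m + k) * indicator S (y m k) + (3/4) ^ (m + k) * indicator S' (y m k))"
    unfolding weight_def sum.distrib[symmetric]
    by (intro sum.cong refl suminf_add summable_weight)
  also have "\<dots> \<le> weight y p U"
    unfolding weight_def using assms
    by (intro sum_mono suminf_le summable_weight summable_add)
       (auto simp: indicator_def)
  finally show ?thesis .
qed

lemma weight_Suc: "weight y (Suc p) S \<le> weight y p S + 4 * (3/4) ^ Suc p"
  unfolding weight_def using suminf_weight_le[of "Suc p"] by simp

lemma weight_0: "weight y 0 S \<le> 4"
  unfolding weight_def using suminf_weight_le[of 0] by simp

lemma weight_ge:
  assumes "m \<le> p" "y m k \<in> S"
  shows "(3/4) ^ (m + k) \<le> weight y p S"
proof -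
  have nn: "0 \<le> (\<Sum>k. (3/4 :: real) ^ (m + k) * indicator S (y m k))" for m
    by (intro suminf_nonneg summable_weight) auto
  have "(3/4 :: real) ^ (m + k) = (\<Sum>k\<in>{k}. (3/4) ^ (m + k) * indicator S (y m k))"
    using assms by simp
  also have "\<dots> \<le> (\<Sum>k. (3/4 :: real) ^ (m + k) * indicator S (y m k))"
    by (intro sum_le_suminf summable_weight) auto
  also have "\<dots> = (\<Sum>m\<in>{m}. \<Sum>k. (3/4 :: real) ^ (m + k) * indicator S (y m k))" by simp
  also have "\<dots> \<le> weight y p S"
    unfolding weight_def using assms nn by (intro sum_mono2) auto
  finally show ?thesis .
qed

text \<open>
  A round consists of two moves. The even move takes a half whose interior has the smaller potential; the
  odd move takes the middle half, which separates the points outside the current interval, and in particular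
  the common endpoint of the two halves, from everything that follows.
\<close>

definition avoid_move :: "(real set \<Rightarrow> nat \<Rightarrow> nat \<Rightarrow> real set \<Rightarrow> real) \<Rightarrow> real set list \<Rightarrow> real set" where
  "avoid_move Y xs =
    (let n = length xs - 1; l = Inf (last xs); u = Sup (last xs); c = (l + u) / 2;
         y = (\<lambda>m k. Y (xs ! 0) m k (xs ! (2 * m)))
     in if odd n then {l + (u - l) / 4..u - (u - l) / 4}
        else if weight y (n div 2) {l<..<c} \<le> weight y (n div 2) {c<..<u} then {l..c} else {c..u})"

lemma legal_avoid_move:
  assumes "closed_interval (last xs)"
  shows "legal_move (1/2) (last xs) (avoid_move Y xs)"
proof -
  obtain l u where lu: "l < u" "last xs = {l..u}" "Inf (last xs) = l" "Sup (last xs) = u"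
      "measure lborel (last xs) = u - l"
    using closed_intervalE[OF assms] .
  have half: "legal_move (1/2) (last xs) {v..w}" if "l \<le> v" "w \<le> u" "w - v = (u - l) / 2" for v w
  proof -
    have "0 < (u - l) / 2" using lu(1) by simp
    then have "v < w" using that(3) by simp
    then show ?thesis
      unfolding legal_move_def lu(5) closed_interval_def using that lu(2) by auto
  qed
  have "legal_move (1/2) (last xs) {l + (u - l) / 4..u - (u - l) / 4}"
    "legal_move (1/2) (last xs) {l..(l + u) / 2}" "legal_move (1/2) (last xs) {(l + u) / 2..u}"
    using lu(1) by (auto intro!: half simp: field_simps)
  then show ?thesis
    unfolding avoid_move_def Let_def lu(3,4) by (simp only: split: if_split) blast
qed

text \<open>\<open>target\<close> collects everything that a play of \<open>avoid_move\<close>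
  guarantees for the intervals \<open>I n = B (2 * n)\<close>, so that the rest of the proof no
  longer mentions the game. The rule \<open>Y\<close> sees only the first interval and the one that
  opens round \<open>m\<close>; this is all the history that the later choice of points
  needs.\<close>

lemma winning_by_avoiding_points:
  fixes Y :: "real set \<Rightarrow> nat \<Rightarrow> nat \<Rightarrow> real set \<Rightarrow> real"
  assumes \<beta>: "0 < \<beta>" "\<beta> < 1"
    and target: "\<And>(I :: nat \<Rightarrow> real set) x.
      \<lbrakk>\<And>n. closed_interval (I n); \<And>n. I (Suc n) \<subseteq> I n;
       \<And>n. measure lborel (I n) = (\<beta> / 2) ^ (2 * n) * measure lborel (I 0);
       \<And>n x y. \<lbrakk>y \<notin> I n; x \<in> I (Suc n)\<rbrakk> \<Longrightarrow> \<beta> / 8 * measure lborel (I n) \<le> \<bar>x - y\<bar>;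
       \<And>m k. Y (I 0) m k (I m) \<notin> I (m + k + 9);
       \<And>n. x \<in> I n\<rbrakk> \<Longrightarrow> x \<in> X"
  shows "schmidt_winning (1 / 2) \<beta> X"
  unfolding schmidt_winning_def
proof (intro exI[of _ "avoid_move Y"] allI, unfold Let_def, intro impI)
  fix B :: "nat \<Rightarrow> real set"
  define A where "A = (\<lambda>n. avoid_move Y (map B [0..<Suc n]))"
  assume B0: "closed_interval (B 0)"
  have legalA: "legal_move (1/2) (B n) (A n)" if "\<forall>k<n. legal_move \<beta> (A k) (B (Suc k))" for n
  proof -
    have "closed_interval (B n)"
      using that B0 by (cases n) (auto simp: legal_move_def)
    then show ?thesis
      using legal_avoid_move[of "map B [0..<Suc n]" Y] unfolding A_def by simp
  qed
  have "\<exists>x\<in>X. (\<Inter>n. B n) = {x}" if lB: "\<And>n. legal_move \<beta> (A n) (B (Suc n))"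
  proof -
    have lA: "legal_move (1/2) (B n) (A n)" for n using legalA lB by blast
    have ci: "closed_interval (B n)" for n
      using B0 lB by (cases n) (auto simp: legal_move_def)
    have sub: "A n \<subseteq> B n" "B (Suc n) \<subseteq> A n" for n
      using lA lB by (auto simp: legal_move_def)
    have step: "measure lborel (B (Suc n)) = \<beta> / 2 * measure lborel (B n)" for n
      using lA[of n] lB[of n] by (simp add: legal_move_def)
    have meas: "measure lborel (B n) = (\<beta> / 2) ^ n * measure lborel (B 0)" for n
      by (induction n) (simp_all add: step)
    obtain l u where lu: "\<And>n. l n < u n" "\<And>n. B n = {l n..u n}"
      using ci unfolding closed_interval_def by metis
    have mB: "measure lborel (B n) = u n - l n" for n
      using lu(1)[of n] by (simp add: lu(2))
    define I where "I = (\<lambda>n. B (2 * n))"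
    have odd_move: "A (Suc (2 * n)) = {l (Suc (2 * n)) + (u (Suc (2 * n)) - l (Suc (2 * n))) / 4..
        u (Suc (2 * n)) - (u (Suc (2 * n)) - l (Suc (2 * n))) / 4}" for n
      unfolding A_def avoid_move_def Let_def using lu(1)[of "Suc (2 * n)"]
      by (simp add: lu(2) less_imp_le)
    have subI: "I (Suc n) \<subseteq> A (Suc (2 * n))" for n
      using sub(2)[of "Suc (2*n)"] by (simp add: I_def)
    define y where "y = (\<lambda>m k. Y (I 0) m k (I m))"
    have y_eq: "weight (\<lambda>m k. Y (map B [0..<Suc (2*p)] ! 0) m k (map B [0..<Suc (2*p)] ! (2 * m))) p S
        = weight y p S" for p S
      unfolding weight_def y_def I_def
      by (intro sum.cong refl) (simp del: upt_Suc)
    have halve: "weight y p (I (Suc p)) \<le> weight y p (I p) / 2" for p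
    proof -
      define c where "c = (l (2*p) + u (2*p)) / 2"
      have lt: "l (2*p) < u (2*p)" by (rule lu)
      define L where "L = {l (2*p)<..<c}"
      define U where "U = {c<..<u (2*p)}"
      have A2p: "A (2*p) = (if weight y p L \<le> weight y p U then {l (2*p)..c} else {c..u (2*p)})"
        unfolding A_def avoid_move_def Let_def L_def U_def y_eq[symmetric] using lt
        by (simp add: lu(2) less_imp_le c_def del: upt_Suc)
           (simp add: lu(2) less_imp_le c_def)
      have sum: "weight y p L + weight y p U \<le> weight y p (I p)"
        by (rule weight_disjoint) (auto simp: L_def U_def I_def lu(2) c_def)
      have in_int: "x \<in> {v<..<w}" if "x \<in> I (Suc p)" "A (2*p) = {v..w}" for x v w
      proof -
        have "B (Suc (2*p)) \<subseteq> {v..w}" using sub(2)[of "2*p"] that(2) by simp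
        then have "v \<le> l (Suc (2*p))" "u (Suc (2*p)) \<le> w"
          using lu(1)[of "Suc (2*p)"] by (auto simp: lu(2))
        moreover have "x \<in> A (Suc (2*p))" using subI that(1) by blast
        ultimately show ?thesis using lu(1)[of "Suc (2*p)"] unfolding odd_move atLeastAtMost_iff greaterThanLessThan_iff
          by argo
      qed
      show ?thesis
      proof (cases "weight y p L \<le> weight y p U")
        case True
        then have "A (2*p) = {l (2*p)..c}" using A2p by simp
          then have "I (Suc p) \<subseteq> L" using in_int unfolding L_def by blast
        from weight_mono[OF this, of y p] show ?thesis using True sum by linarith
      next
        case False
        then have "A (2*p) = {c..u (2*p)}" using A2p by simp
          then have "I (Suc p) \<subseteq> U" using in_int unfolding U_def by blast
        from weight_mono[OF this, of y p] show ?thesis using False sum by linarith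
      qed
    qed
    \<comment> \<open>The constant 12 solves \<open>c / 2 + 4 * (3/4) = (3/4) * c\<close>: halving
      the old potential and adding the points named in the new round together gain a factor
      \<open>3/4\<close>.\<close>
    have pot: "weight y p (I p) \<le> 12 * (3/4) ^ p" for p
    proof (induction p)
      case 0
      then show ?case using weight_0[of y "I 0"] by simp
    next
      case (Suc p)
      have "weight y (Suc p) (I (Suc p)) \<le> weight y p (I (Suc p)) + 4 * (3/4) ^ Suc p"
        by (rule weight_Suc)
      also have "\<dots> \<le> 12 * (3/4) ^ p / 2 + 4 * (3/4) ^ Suc p"
        using halve[of p] Suc.IH by linarith
      also have "\<dots> = 12 * (3/4) ^ Suc p" by simp
      finally show ?case .
    qed
    have dec: "B (Suc n) \<subseteq> B n" for n using sub by blast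
    have "compact (B n)" "B n \<noteq> {}" for n using lu(1)[of n] by (auto simp: lu(2))
    moreover have "B n \<subseteq> B m" if "m \<le> n" for m n
      using lift_Suc_antimono_le[of B, OF dec that] .
    ultimately have "(\<Inter>n. B n) \<noteq> {}" by (intro compact_nest)
    then obtain x where x: "\<And>n. x \<in> B n" by blast
    have "x' = x" if "\<And>n. x' \<in> B n" for x'
    proof (rule ccontr)
      assume "x' \<noteq> x"
      have "(\<lambda>n. (\<beta> / 2) ^ n * measure lborel (B 0)) \<longlonglongrightarrow> 0 * measure lborel (B 0)"
        using \<beta> by (intro tendsto_intros LIMSEQ_realpow_zero) auto
      then have "eventually (\<lambda>n. (\<beta> / 2) ^ n * measure lborel (B 0) < \<bar>x' - x\<bar>) sequentially"
        using \<open>x' \<noteq> x\<close> by (intro order_tendstoD) auto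
      then obtain n where "(\<beta> / 2) ^ n * measure lborel (B 0) < \<bar>x' - x\<bar>"
        unfolding eventually_sequentially by blast
      then have "u n - l n < \<bar>x' - x\<bar>" using meas[of n] mB[of n] by linarith
      then show False using x[of n] that[of n] unfolding lu(2) by auto
    qed
    then have "(\<Inter>n. B n) = {x}" using x by blast
    moreover have "x \<in> X"
    proof (rule target)
      show "closed_interval (I n)" for n using ci by (simp add: I_def)
      show "I (Suc n) \<subseteq> I n" for n
        using dec[of "2*n"] dec[of "Suc (2*n)"] by (auto simp: I_def)
      show "measure lborel (I n) = (\<beta> / 2) ^ (2 * n) * measure lborel (I 0)" for n
        using meas[of "2 * n"] by (simp add: I_def)
      show "x \<in> I n" for n using x by (simp add: I_def)
      show "\<beta> / 8 * measure lborel (I n) \<le> \<bar>x - y\<bar>" if "y \<notin> I n" "x \<in> I (Suc n)" for n x y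
      proof -
        have "y \<notin> B (Suc (2*n))" using that(1) dec[of "2*n"] by (auto simp: I_def)
        moreover have "x \<in> A (Suc (2*n))" using that(2) subI by blast
        \<comment> \<open>\<open>B (2n+1)\<close> has \<open>\<beta> / 2\<close> times the length of
          \<open>I n\<close>, and the odd move trims a quarter of it at either end; hence the
          constant \<open>\<beta> / 8\<close>.\<close>
        ultimately have "measure lborel (B (Suc (2*n))) / 4 \<le> \<bar>x - y\<bar>"
          unfolding odd_move mB unfolding lu(2) atLeastAtMost_iff by argo
        then show ?thesis using step[of "2*n"] by (simp add: I_def)
      qed
      show "Y (I 0) m k (I m) \<notin> I (m + k + 9)" for m k
      proof
        assume "Y (I 0) m k (I m) \<in> I (m + k + 9)"
        then have "(3/4) ^ (m + k) \<le> weight y (m + k + 9) (I (m + k + 9))"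
          by (intro weight_ge) (auto simp: y_def)
        also have "\<dots> \<le> 12 * (3/4) ^ (m + k + 9)" by (rule pot)
        also have "\<dots> < (3/4) ^ (m + k)" by (simp add: power_add power_divide field_simps)
        finally show False by simp
      qed
    qed
    ultimately show ?thesis by blast
  qed
  then show "(\<forall>n. (\<forall>k<n. legal_move \<beta> (avoid_move Y (map B [0..<Suc k])) (B (Suc k)))
        \<longrightarrow> legal_move (1/2) (B n) (avoid_move Y (map B [0..<Suc n]))) \<and>
      ((\<forall>n. legal_move \<beta> (avoid_move Y (map B [0..<Suc n])) (B (Suc n))) \<longrightarrow>
        (\<exists>x\<in>X. (\<Inter>n. B n) = {x}))"
    using legalA unfolding A_def by blast
qed

section \<open>From named points to classes of centres\<close>

text \<open>Uniqueness of the centre is a premise inside the last clause rather than a requirement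
  on \<open>P\<close>: it depends on what has been avoided earlier in the same play and can only be
  proved by induction along that play.\<close>

definition avoiding :: "real \<Rightarrow> (nat \<Rightarrow> nat \<Rightarrow> real \<Rightarrow> bool) \<Rightarrow> (nat \<Rightarrow> real set) \<Rightarrow> bool" where
  "avoiding \<beta> P I \<longleftrightarrow>
     (\<forall>n. closed_interval (I n)) \<and> (\<forall>n. I (Suc n) \<subseteq> I n) \<and>
     (\<forall>n. measure lborel (I n) = (\<beta> / 2) ^ (2 * n) * measure lborel (I 0)) \<and>
     (\<forall>n x y. y \<notin> I n \<longrightarrow> x \<in> I (Suc n) \<longrightarrow> \<beta> / 8 * measure lborel (I n) \<le> \<bar>x - y\<bar>) \<and>
     (\<forall>m k X. X \<in> I m \<longrightarrow> P m k X \<longrightarrow> (\<forall>X' \<in> I m. P m k X' \<longrightarrow> X' = X) \<longrightarrow> X \<notin> I (m + k + 9))"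

lemma avoidingD:
  assumes "avoiding \<beta> P I"
  shows "closed_interval (I n)" "I (Suc n) \<subseteq> I n"
    "measure lborel (I n) = (\<beta> / 2) ^ (2 * n) * measure lborel (I 0)"
    "y \<notin> I n \<Longrightarrow> x \<in> I (Suc n) \<Longrightarrow> \<beta> / 8 * measure lborel (I n) \<le> \<bar>x - y\<bar>"
    "X \<in> I m \<Longrightarrow> P m k X \<Longrightarrow> (\<And>X'. X' \<in> I m \<Longrightarrow> P m k X' \<Longrightarrow> X' = X) \<Longrightarrow> X \<notin> I (m + k + 9)"
  using assms unfolding avoiding_def by blast+

text \<open>\<open>P\<close> may depend on the first interval \<open>J\<close>, since the time scale
  and all smallness constants are fixed only once \<open>J\<close> is known.\<close>

lemma winning_by_avoidance:
  assumes \<beta>: "0 < \<beta>" "\<beta> < 1"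
    and classes: "\<And>J. closed_interval J \<Longrightarrow>
      \<exists>P. \<forall>I x. I 0 = J \<and> avoiding \<beta> P I \<and> (\<forall>n. x \<in> I n) \<longrightarrow> x \<in> X"
  shows "schmidt_winning (1 / 2) \<beta> X"
proof -
  have "\<forall>J. \<exists>P. closed_interval J \<longrightarrow>
      (\<forall>I x. I 0 = J \<and> avoiding \<beta> P I \<and> (\<forall>n. x \<in> I n) \<longrightarrow> x \<in> X)"
    using classes by blast
  from choice[OF this] obtain P where P: "\<And>J I x. closed_interval J \<Longrightarrow>
      I 0 = J \<Longrightarrow> avoiding \<beta> (P J) I \<Longrightarrow> (\<And>n. x \<in> I n) \<Longrightarrow> x \<in> X"
    by blast
  show ?thesis
  \<comment> \<open>Where the centre in \<open>I\<close> is not unique, \<open>SOME\<close> yields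
    an arbitrary centre or an unspecified real. This is harmless, because \<open>avoiding\<close>
    claims nothing in these cases.\<close>
  proof (rule winning_by_avoiding_points[where X = X and Y = "\<lambda>J m k I. SOME X. X \<in> I \<and> P J m k X", OF \<beta>])
    fix I :: "nat \<Rightarrow> real set" and x
    assume I: "\<And>n. closed_interval (I n)" "\<And>n. I (Suc n) \<subseteq> I n"
       "\<And>n. measure lborel (I n) = (\<beta> / 2) ^ (2 * n) * measure lborel (I 0)"
       "\<And>n x y. \<lbrakk>y \<notin> I n; x \<in> I (Suc n)\<rbrakk> \<Longrightarrow> \<beta> / 8 * measure lborel (I n) \<le> \<bar>x - y\<bar>"
       "\<And>m k. (SOME X. X \<in> I m \<and> P (I 0) m k X) \<notin> I (m + k + 9)"
       "\<And>n. x \<in> I n"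
    have "X \<notin> I (m + k + 9)"
      if "X \<in> I m" "P (I 0) m k X" "\<forall>X' \<in> I m. P (I 0) m k X' \<longrightarrow> X' = X" for m k X
    proof -
      have "(SOME X. X \<in> I m \<and> P (I 0) m k X) = X" using that by (intro some_equality) blast+
      then show ?thesis using I(5)[of m k] by simp
    qed
    then have "avoiding \<beta> (P (I 0)) I"
      unfolding avoiding_def using I(1-4) by (intro conjI allI impI)
    then show "x \<in> X" by (rule P[OF I(1) refl _ I(6)])
  qed
qed

section \<open>Short vectors and uniqueness of centres\<close>

text \<open>
  In the coordinates \<open>(q x - p1, q b + a p1 - p2, q)\<close> for points and
  \<open>(A + B a, B, (A + B a) x + (C + B b))\<close> for lines, only one entry depends on \<open>x\<close>. The shear by \<open>a\<close> that
  this neglects is harmless because \<open>j \<le> i\<close>.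
\<close>

definition short_vec :: "real \<Rightarrow> real \<Rightarrow> real \<Rightarrow> real \<Rightarrow> real \<Rightarrow> real \<Rightarrow> real \<Rightarrow> bool" where
  "short_vec i j a b \<eta> t x \<longleftrightarrow> (\<exists>p1 p2 q :: int. \<not> (p1 = 0 \<and> p2 = 0 \<and> q = 0) \<and>
     \<bar>of_int q\<bar> \<le> \<eta> * t \<and> \<bar>of_int q * x - of_int p1\<bar> \<le> \<eta> * t powr - i \<and>
     \<bar>of_int q * b + a * of_int p1 - of_int p2\<bar> \<le> \<eta> * t powr - j)"

definition short_covec :: "real \<Rightarrow> real \<Rightarrow> real \<Rightarrow> real \<Rightarrow> real \<Rightarrow> real \<Rightarrow> real \<Rightarrow> bool" where
  "short_covec i j a b \<eta> t x \<longleftrightarrow> (\<exists>A B C :: int. \<not> (A = 0 \<and> B = 0 \<and> C = 0) \<and>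
     \<bar>of_int A + of_int B * a\<bar> \<le> \<eta> * t powr i \<and> \<bar>of_int B\<bar> \<le> \<eta> * t powr j \<and>
     \<bar>(of_int A + of_int B * a) * x + (of_int C + of_int B * b)\<bar> \<le> \<eta> * t powr - 1)"

text \<open>The last quantity is \<open>q\<close> times the vertical distance of the shifted point
  from the line \<open>y = a x + b\<close>. Only the bound on \<open>q\<close> carries the factor
  \<open>K\<close>: it lets the point be announced up to a factor \<open>K\<close> ahead of its own
  time \<open>q / \<eta>\<close>.\<close>

definition point_centre :: "real \<Rightarrow> real \<Rightarrow> real \<Rightarrow> real \<Rightarrow> real \<Rightarrow> real \<Rightarrow> real \<Rightarrow> real \<Rightarrow> real \<Rightarrow> bool" where
  "point_centre j a b \<gamma> \<delta> \<eta> K t X \<longleftrightarrow> (\<exists>p1 p2 q :: int. 1 \<le> q \<and>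
     X = (of_int p1 + \<gamma>) / of_int q \<and> of_int q \<le> \<eta> * K * t \<and>
     \<bar>of_int q * b + a * (of_int p1 + \<gamma>) - \<delta> - of_int p2\<bar> \<le> \<eta> * t powr - j)"

text \<open>\<open>X\<close> is the abscissa at which \<open>A x + B y + C = 0\<close> meets
  \<open>y = a x + b\<close>. The two bounds are dilated separately because uniqueness depends only
  on \<open>D * F\<close> and \<open>D\<^sup>2\<close>: a small \<open>D\<close> pays for a large
  \<open>F\<close>.\<close>

definition line_centre :: "real \<Rightarrow> real \<Rightarrow> real \<Rightarrow> real \<Rightarrow> real \<Rightarrow> real \<Rightarrow> real \<Rightarrow> real \<Rightarrow> real \<Rightarrow> bool" where
  "line_centre i j a b \<eta> D F t X \<longleftrightarrow> (\<exists>A B C :: int. of_int A + of_int B * a \<noteq> 0 \<and>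
     X = - (of_int C + of_int B * b) / (of_int A + of_int B * a) \<and>
     \<bar>of_int A + of_int B * a\<bar> \<le> \<eta> * D * t powr i \<and> \<bar>of_int B\<bar> \<le> \<eta> * F * t powr j)"

lemma abs_mult_le:
  fixes x y :: real
  assumes "\<bar>x\<bar> \<le> u" "\<bar>y\<bar> \<le> v"
  shows "\<bar>x * y\<bar> \<le> u * v"
  unfolding abs_mult using assms by (intro mult_mono) auto

lemma abs_cross_le:
  fixes x y x' y' :: real
  assumes "\<bar>x\<bar> \<le> u" "\<bar>x'\<bar> \<le> u" "\<bar>y\<bar> \<le> v" "\<bar>y'\<bar> \<le> v"
  shows "\<bar>x * y' - x' * y\<bar> \<le> 2 * (u * v)"
  using abs_mult_le[of x u y' v] abs_mult_le[of x' u y v] assms by linarith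

text \<open>The line \<open>(A, B, C)\<close> through the two rational points has
  \<open>B = q q' (X' - X)\<close>. Distinct centres therefore make it nonzero, and their closeness
  makes it a short covector at \<open>X\<close>.\<close>

lemma homogeneous_centre_unique:
  assumes ij: "i + j = 1" and t: "0 < t" and \<eta>: "0 < \<eta>" "2 * \<eta> * K\<^sup>2 \<le> 1" and K: "1 \<le> K"
    and X: "point_centre j a b 0 0 \<eta> K t X" and X': "point_centre j a b 0 0 \<eta> K t X'"
    and near: "\<bar>X - X'\<bar> \<le> t powr (- 1 - i)"
    and no: "\<not> short_covec i j a b \<eta> t X"
  shows "X = X'"
proof -
  obtain p1 p2 q :: int where q: "1 \<le> q" "X = of_int p1 / of_int q" "of_int q \<le> \<eta> * K * t"
    and h: "\<bar>of_int q * b + a * of_int p1 - of_int p2\<bar> \<le> \<eta> * t powr - j"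
    using X unfolding point_centre_def by auto
  obtain p1' p2' q' :: int where q': "1 \<le> q'" "X' = of_int p1' / of_int q'" "of_int q' \<le> \<eta> * K * t"
    and h': "\<bar>of_int q' * b + a * of_int p1' - of_int p2'\<bar> \<le> \<eta> * t powr - j"
    using X' unfolding point_centre_def by auto
  define A where "A = p2 * q' - q * p2'"
  define B where "B = q * p1' - p1 * q'"
  define C where "C = p1 * p2' - p2 * p1'"
  have p1: "of_int p1 = of_int q * X" and p1': "of_int p1' = of_int q' * X'"
    using q q' by auto
  have aq: "\<bar>of_int q :: real\<bar> \<le> \<eta> * K * t" "\<bar>of_int q' :: real\<bar> \<le> \<eta> * K * t"
    using q q' by auto
  have K2: "2 * \<eta> * K \<le> 1"
  proof -
    have "2 * \<eta> * K \<le> 2 * \<eta> * K\<^sup>2" using \<eta> K by (intro mult_left_mono) (auto simp: power2_eq_square)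
    then show ?thesis using \<eta> by linarith
  qed
  have K3: "\<eta> * K \<le> 1" using K2 mult_pos_pos[of \<eta> K] \<eta> K by linarith
  have j: "j = 1 - i" using ij by simp
  have tj: "t * t powr - j = t powr i" "t * t powr (-1 - i) = t powr - i"
    "t powr - i * t powr - j = t powr - 1"
    using t j by (simp_all add: powr_mult_base powr_add[symmetric])
  have ti: "t * t powr - i = t powr j" using t j by (simp add: powr_mult_base)
  have "of_int A + of_int B * a =
      of_int q * (of_int q' * b + a * of_int p1' - of_int p2') - of_int q' * (of_int q * b + a * of_int p1 - of_int p2)"
    unfolding A_def B_def by (simp add: algebra_simps)
  then have "\<bar>of_int A + of_int B * a\<bar> \<le> 2 * ((\<eta> * K * t) * (\<eta> * t powr - j))"
    using abs_cross_le[OF aq h h'] by simp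
  also have "\<dots> = (2 * \<eta> * K) * (\<eta> * t powr i)" unfolding tj(1)[symmetric] by simp
  also have "\<dots> \<le> \<eta> * t powr i" using K2 \<eta> K by (intro mult_left_le_one_le) auto
  finally have 1: "\<bar>of_int A + of_int B * a\<bar> \<le> \<eta> * t powr i" .
  have e': "\<bar>of_int q' * (X' - X)\<bar> \<le> \<eta> * K * t powr - i"
  proof -
    have "\<bar>X' - X\<bar> \<le> t powr (- 1 - i)" using near by (simp add: abs_minus_commute)
    from abs_mult_le[OF aq(2) this] show ?thesis using tj(2) by (simp add: mult.assoc)
  qed
  have B_eq: "real_of_int B = of_int q * (of_int q' * (X' - X))"
    unfolding B_def by (simp add: p1 p1' algebra_simps)
  have "\<bar>real_of_int B\<bar> \<le> (\<eta> * K * t) * (\<eta> * K * t powr - i)"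
    unfolding B_eq by (rule abs_mult_le[OF aq(1) e'])
  also have "\<dots> = (\<eta> * K\<^sup>2) * (\<eta> * t powr j)" unfolding ti[symmetric] by (simp add: power2_eq_square)
  also have "\<dots> \<le> \<eta> * t powr j" using \<eta> by (intro mult_left_le_one_le) auto
  finally have 2: "\<bar>real_of_int B\<bar> \<le> \<eta> * t powr j" .
  \<comment> \<open>The line passes through the first point, so its value at the point of
    \<open>y = a x + b\<close> above \<open>X\<close> is a multiple of the vertical defect of that
    point.\<close>
  have C_eq: "(of_int A + of_int B * a) * X + (of_int C + of_int B * b) =
      (of_int q' * (X' - X)) * (of_int q * b + a * of_int p1 - of_int p2)"
    unfolding A_def B_def C_def by (simp add: p1 p1' algebra_simps)
  have "\<bar>(of_int A + of_int B * a) * X + (of_int C + of_int B * b)\<bar> \<le> (\<eta> * K * t powr - i) * (\<eta> * t powr - j)"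
    unfolding C_eq by (rule abs_mult_le[OF e' h])
  also have "\<dots> = (\<eta> * K) * (\<eta> * t powr - 1)" unfolding tj(3)[symmetric] by simp
  also have "\<dots> \<le> \<eta> * t powr - 1" using K3 \<eta> K by (intro mult_left_le_one_le) auto
  finally have 3: "\<bar>(of_int A + of_int B * a) * X + (of_int C + of_int B * b)\<bar> \<le> \<eta> * t powr - 1" .
  have "B = 0" using no 1 2 3 unfolding short_covec_def by blast
  then show ?thesis using B_eq q(1) q'(1) by auto
qed

text \<open>Subtracting the two points cancels the shift and leaves an integer vector; at
  \<open>X\<close> the first point contributes nothing to its horizontal entry. The two vertical
  defects add up, whence the factor 2 in \<open>2 * \<kappa> * K \<le> \<eta>\<close>.\<close>

lemma inhomogeneous_centre_unique:
  assumes t: "0 < t" and \<kappa>: "0 < \<kappa>" "2 * \<kappa> * K \<le> \<eta>" and K: "1 \<le> K"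
    and X: "point_centre j a b \<gamma> \<delta> \<kappa> K t X" and X': "point_centre j a b \<gamma> \<delta> \<kappa> K t X'"
    and near: "\<bar>X - X'\<bar> \<le> t powr (- 1 - i)"
    and no: "\<not> short_vec i j a b \<eta> t X"
  shows "X = X'"
proof -
  obtain p1 p2 q :: int where q: "1 \<le> q" "X = (of_int p1 + \<gamma>) / of_int q" "of_int q \<le> \<kappa> * K * t"
    and h: "\<bar>of_int q * b + a * (of_int p1 + \<gamma>) - \<delta> - of_int p2\<bar> \<le> \<kappa> * t powr - j"
    using X unfolding point_centre_def by auto
  obtain p1' p2' q' :: int where q': "1 \<le> q'" "X' = (of_int p1' + \<gamma>) / of_int q'" "of_int q' \<le> \<kappa> * K * t"
    and h': "\<bar>of_int q' * b + a * (of_int p1' + \<gamma>) - \<delta> - of_int p2'\<bar> \<le> \<kappa> * t powr - j"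
    using X' unfolding point_centre_def by auto
  have p1: "of_int p1 = of_int q * X - \<gamma>" and p1': "of_int p1' = of_int q' * X' - \<gamma>"
    using q q' by auto
  have k2: "\<kappa> * K \<le> \<eta>" "2 * \<kappa> \<le> \<eta>"
    using \<kappa> K mult_left_mono[OF K, of \<kappa>] by linarith+
  have 1: "\<bar>of_int (q' - q)\<bar> \<le> \<eta> * t"
  proof -
    have "\<bar>real_of_int (q' - q)\<bar> \<le> \<kappa> * K * t" using q q' by auto
    also have "\<dots> \<le> \<eta> * t" using k2 t by (intro mult_right_mono) auto
    finally show ?thesis .
  qed
  have "of_int (q' - q) * X - of_int (p1' - p1) = of_int q' * (X - X')"
    by (simp add: p1 p1' algebra_simps)
  then have "\<bar>of_int (q' - q) * X - of_int (p1' - p1)\<bar> \<le> (\<kappa> * K * t) * t powr (-1 - i)"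
    using abs_mult_le[OF _ near, of "of_int q'"] q' by auto
  also have "\<dots> = (\<kappa> * K) * t powr - i" using t by (simp add: powr_mult_base)
  also have "\<dots> \<le> \<eta> * t powr - i" using k2 by (intro mult_right_mono) auto
  finally have 2: "\<bar>of_int (q' - q) * X - of_int (p1' - p1)\<bar> \<le> \<eta> * t powr - i" .
  have "of_int (q' - q) * b + a * of_int (p1' - p1) - of_int (p2' - p2) =
     (of_int q' * b + a * (of_int p1' + \<gamma>) - \<delta> - of_int p2') - (of_int q * b + a * (of_int p1 + \<gamma>) - \<delta> - of_int p2)"
    by (simp add: algebra_simps)
  then have "\<bar>of_int (q' - q) * b + a * of_int (p1' - p1) - of_int (p2' - p2)\<bar> \<le> 2 * \<kappa> * t powr - j"
    using h h' by linarith
  also have "\<dots> \<le> \<eta> * t powr - j" using k2 by (intro mult_right_mono) auto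
  finally have 3: "\<bar>of_int (q' - q) * b + a * of_int (p1' - p1) - of_int (p2' - p2)\<bar> \<le> \<eta> * t powr - j" .
  have "p1' - p1 = 0 \<and> p2' - p2 = 0 \<and> q' - q = 0"
    using no 1 2 3 unfolding short_vec_def by blast
  then show ?thesis using q q' by simp
qed

text \<open>The cross product of the two lines has sheared vertical entry
  \<open>l l' (X - X')\<close>. Since \<open>l\<close> and \<open>l'\<close> are nonzero, even a
  vanishing cross product, as for coinciding lines, forces \<open>X = X'\<close>.\<close>

lemma line_centre_unique:
  assumes ij: "i + j = 1" and t: "0 < t" and \<eta>: "0 < \<eta>" and D: "0 < D" "2 * \<eta> * D * F \<le> 1" "\<eta> * D\<^sup>2 \<le> 1"
    and F: "0 < F"
    and X: "line_centre i j a b \<eta> D F t X" and X': "line_centre i j a b \<eta> D F t X'"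
    and near: "\<bar>X - X'\<bar> \<le> t powr (- 1 - i)"
    and no: "\<not> short_vec i j a b \<eta> t X"
  shows "X = X'"
proof -
  obtain A B C :: int where l0: "of_int A + of_int B * a \<noteq> 0"
     and X_eq: "X = - (of_int C + of_int B * b) / (of_int A + of_int B * a)"
     and A: "\<bar>of_int A + of_int B * a\<bar> \<le> \<eta> * D * t powr i" and B: "\<bar>real_of_int B\<bar> \<le> \<eta> * F * t powr j"
    using X unfolding line_centre_def by auto
  obtain A' B' C' :: int where l0': "of_int A' + of_int B' * a \<noteq> 0"
     and X_eq': "X' = - (of_int C' + of_int B' * b) / (of_int A' + of_int B' * a)"
     and A': "\<bar>of_int A' + of_int B' * a\<bar> \<le> \<eta> * D * t powr i" and B': "\<bar>real_of_int B'\<bar> \<le> \<eta> * F * t powr j"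
    using X' unfolding line_centre_def by auto
  define l l' where "l = of_int A + of_int B * a" and "l' = of_int A' + of_int B' * a"
  have c: "of_int C + of_int B * b = - l * X" and c': "of_int C' + of_int B' * b = - l' * X'"
    using X_eq X_eq' l0 l0' unfolding l_def l'_def by (simp_all add: field_simps)
  have C: "of_int C = - l * X - of_int B * b" and C': "of_int C' = - l' * X' - of_int B' * b"
    using c c' by linarith+
  have AA: "of_int A = l - of_int B * a" "of_int A' = l' - of_int B' * a"
    by (simp_all add: l_def l'_def)
  have l: "\<bar>l\<bar> \<le> \<eta> * D * t powr i" "\<bar>l'\<bar> \<le> \<eta> * D * t powr i" using A A' by (simp_all add: l_def l'_def)
  define p1 where "p1 = B * C' - C * B'"
  define p2 where "p2 = C * A' - A * C'"
  define q where "q = A * B' - B * A'"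
  have j: "j = 1 - i" using ij by simp
  have tt: "t powr i * t powr j = t" "t powr i * t powr (- 1 - i) = t powr - 1"
     "t powr j * t powr - 1 = t powr - i" "t powr i * t powr - 1 = t powr - j"
    using t j by (simp_all add: powr_add[symmetric] powr_diff powr_minus field_simps)
  have "of_int q = l * of_int B' - l' * of_int B"
    unfolding q_def by (simp add: AA algebra_simps)
  then have "\<bar>real_of_int q\<bar> \<le> 2 * ((\<eta> * D * t powr i) * (\<eta> * F * t powr j))"
    using abs_cross_le[OF l B B'] by simp
  also have "\<dots> = (2 * \<eta> * D * F) * (\<eta> * (t powr i * t powr j))" by simp
  also have "\<dots> = (2 * \<eta> * D * F) * (\<eta> * t)" unfolding tt ..
  also have "\<dots> \<le> \<eta> * t" using D F \<eta> t by (intro mult_left_le_one_le) auto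
  finally have 1: "\<bar>real_of_int q\<bar> \<le> \<eta> * t" .
  have lX: "\<bar>l' * (X - X')\<bar> \<le> \<eta> * D * t powr - 1"
    using abs_mult_le[OF l(2) near] tt(2) by (simp add: mult.assoc)
  have "of_int q * X - of_int p1 = - of_int B * (l' * (X - X'))"
    unfolding q_def p1_def by (simp add: AA C C' algebra_simps)
  then have "\<bar>of_int q * X - of_int p1\<bar> \<le> (\<eta> * F * t powr j) * (\<eta> * D * t powr - 1)"
    using abs_mult_le[OF _ lX, of "- of_int B"] B by simp
  also have "\<dots> = (\<eta> * D * F) * (\<eta> * t powr - i)" unfolding tt(3)[symmetric] by simp
  also have "\<dots> \<le> \<eta> * t powr - i"
    using D F \<eta> mult_pos_pos[OF mult_pos_pos[OF \<eta> D(1)] F] by (intro mult_left_le_one_le) auto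
  finally have 2: "\<bar>of_int q * X - of_int p1\<bar> \<le> \<eta> * t powr - i" .
  have h_eq: "of_int q * b + a * of_int p1 - of_int p2 = l * (l' * (X - X'))"
    unfolding q_def p1_def p2_def by (simp add: AA C C' algebra_simps)
  have "\<bar>of_int q * b + a * of_int p1 - of_int p2\<bar> \<le> (\<eta> * D * t powr i) * (\<eta> * D * t powr - 1)"
    unfolding h_eq by (rule abs_mult_le[OF l(1) lX])
  also have "\<dots> = (\<eta> * D\<^sup>2) * (\<eta> * t powr - j)" unfolding tt(4)[symmetric] by (simp add: power2_eq_square)
  also have "\<dots> \<le> \<eta> * t powr - j" using D \<eta> by (intro mult_left_le_one_le) auto
  finally have 3: "\<bar>of_int q * b + a * of_int p1 - of_int p2\<bar> \<le> \<eta> * t powr - j" .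
  have "p1 = 0 \<and> p2 = 0 \<and> q = 0"
    using no 1 2 3 unfolding short_vec_def by blast
  then have "l * (l' * (X - X')) = 0" unfolding h_eq[symmetric] by simp
  then show ?thesis using l0 l0' by (simp add: l_def l'_def)
qed

section \<open>The obstacles along a play\<close>

lemma geometric_last:
  fixes c S H :: real
  assumes "0 < c" "1 < S" "P 0" "\<And>m. P m \<Longrightarrow> c * S ^ m \<le> H"
  obtains m where "P m" "\<not> P (Suc m)"
proof -
  obtain N where "H / c < S ^ N" using real_arch_pow[OF assms(2)] by blast
  then have "\<not> P N" using assms(1) assms(4)[of N] by (auto simp: field_simps)
  then have "\<exists>m. P m \<and> \<not> P (Suc m)" using assms(3) by (metis nat_induct)
  then show ?thesis using that by blast
qed

text \<open>Points of either kind need only one class, because they are announced a bounded factor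
  ahead. Lines may be announced arbitrarily early and are sorted by how early, which also gives a
  line of a higher class the longer delay that it can afford.\<close>

definition centre :: "real \<Rightarrow> real \<Rightarrow> real \<Rightarrow> real \<Rightarrow> real \<Rightarrow> real \<Rightarrow> real \<Rightarrow> real \<Rightarrow> real \<Rightarrow>
    (nat \<Rightarrow> real) \<Rightarrow> (nat \<Rightarrow> real) \<Rightarrow> nat \<Rightarrow> real \<Rightarrow> real \<Rightarrow> bool" where
  "centre i j a b \<gamma> \<delta> \<eta> \<kappa> K D F k t X \<longleftrightarrow>
     (if k = 0 then point_centre j a b 0 0 \<eta> K t X
      else if k = 1 then point_centre j a b \<gamma> \<delta> \<kappa> K t X
      else line_centre i j a b \<eta> (D (k - 2)) (F (k - 2)) t X)"

text \<open>
  Here \<open>I n\<close> is the interval of B at the start of round \<open>n\<close>, and \<open>T n\<close> its time, so that its length is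
  \<open>T n powr (- 1 - i)\<close> and shrinks by the factor \<open>R\<close> per round. The line obstacle with \<open>l = A + B a\<close> has height
  \<open>H = max ((\<bar>l\<bar> / \<eta>) powr (1 / i)) ((\<bar>B\<bar> / \<eta>) powr (1 / j))\<close> and radius \<open>\<eta> / (H * \<bar>l\<bar>)\<close>. It is announced in the
  last round \<open>m\<close> such that the ratio \<open>\<tau> = H / T m\<close> is at least \<open>K\<close> and the radius is at most
  \<open>\<tau> powr - e\<close> times the length of \<open>I m\<close>, in the class \<open>k + 2\<close> with \<open>K * \<mu> ^ k \<le> \<tau> < K * \<mu> ^ Suc k\<close>.
\<close>

locale nested_intervals =
  fixes i j a b \<gamma> \<delta> e c0 x0 t0 S G \<eta> R \<mu> K K' E c1 \<kappa> :: real and T :: "nat \<Rightarrow> real"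
    and D F :: "nat \<Rightarrow> real" and I :: "nat \<Rightarrow> real set"
  assumes ij: "0 < j" "0 < i" "i + j = 1" and e: "0 < e" "e \<le> i" "2 * e < 1"
    and c0: "0 < c0" and x0: "0 \<le> x0" and t0: "0 < t0" and S: "1 < S" and G: "1 \<le> G"
    and R_def: "R = S powr (1 + i)" and \<mu>_def: "\<mu> = R powr (1 / e)"
    and K_def: "K = (G * R ^ 12) powr (1 / e)" and K'_def: "K' = K * S"
    and E_def: "E = R + K' powr (1 + i)" and c1_def: "c1 = min 1 (c0 / (2 * (1 + x0)))"
    and \<kappa>_def: "\<kappa> = \<eta> / (2 * K')"
    and T_def: "T = (\<lambda>n. t0 * S ^ n)"
    and D_def: "D = (\<lambda>k. E * (K * \<mu> ^ k) powr (e - 1))"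
    and F_def: "F = (\<lambda>k. (K * \<mu> ^ Suc k) powr j)"
    and \<eta>: "0 < \<eta>" "\<eta> \<le> 1" "2 * \<eta> * K'\<^sup>2 \<le> 1" "2 * \<eta> * E\<^sup>2 * \<mu> \<le> 1"
      "\<eta> * t0 powr - i < 1" "\<eta> * t0 powr - j < 1" "\<eta> * t0 powr - 1 < 1" "K * t0 * \<eta> \<le> 1" "\<eta> \<le> c0 / 2"
      "\<eta> powr e \<le> c1 * t0 powr (- 1 - i) * t0 powr e"
    and dioph: "\<And>A B C :: int. B \<noteq> 0 \<Longrightarrow> c0 * \<bar>of_int B\<bar> powr (- ((1 - 2 * e) / j)) \<le>
        max \<bar>of_int A + of_int B * a\<bar> \<bar>of_int C + of_int B * b\<bar>"
    and I_dec: "\<And>n. I (Suc n) \<subseteq> I n"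
    and I_bounded: "\<And>x. x \<in> I 0 \<Longrightarrow> \<bar>x\<bar> \<le> x0"
    and I_diam: "\<And>n x y. x \<in> I n \<Longrightarrow> y \<in> I n \<Longrightarrow> \<bar>x - y\<bar> \<le> T n powr (- 1 - i)"
    and I_far: "\<And>n x y. y \<notin> I n \<Longrightarrow> x \<in> I (Suc n) \<Longrightarrow> T n powr (- 1 - i) \<le> G * \<bar>x - y\<bar>"
    and I_avoid: "\<And>m k X. X \<in> I m \<Longrightarrow> centre i j a b \<gamma> \<delta> \<eta> \<kappa> K' D F k (T m) X \<Longrightarrow>
        (\<And>X'. X' \<in> I m \<Longrightarrow> centre i j a b \<gamma> \<delta> \<eta> \<kappa> K' D F k (T m) X' \<Longrightarrow> X' = X) \<Longrightarrow> X \<notin> I (m + k + 9)"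
begin

section \<open>Elementary bounds on the constants and times\<close>

lemma i_less: "i < 1" using ij by simp

lemma R: "1 < R" "S \<le> R"
proof -
  show "1 < R" unfolding R_def using S ij by simp
  have "S powr 1 \<le> S powr (1 + i)" using S ij by (intro powr_mono) auto
  then show "S \<le> R" using S by (simp add: R_def)
qed

lemma R12: "1 < R ^ 12" using R(1) by (intro one_less_power) auto

lemma GR12: "1 < G * R ^ 12"
proof -
  have "1 * R ^ 12 \<le> G * R ^ 12" using G R12 by (intro mult_right_mono) auto
  then show ?thesis using R12 by linarith
qed

lemma le_powr_inverse: "x \<le> x powr (1 / e)" if "1 \<le> x" for x :: real
proof -
  have "x powr 1 \<le> x powr (1 / e)" using that e by (intro powr_mono) auto
  then show ?thesis using that by simp
qed

lemma \<mu>: "R \<le> \<mu>" "1 < \<mu>" using le_powr_inverse[of R] R by (auto simp: \<mu>_def)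

lemma K: "G * R ^ 12 \<le> K" "1 < K" using le_powr_inverse[of "G * R ^ 12"] GR12 by (auto simp: K_def)

lemma S12: "S ^ 12 \<le> K"
proof -
  have "S ^ 12 \<le> R ^ 12" using R S by (intro power_mono) auto
  also have "\<dots> = 1 * R ^ 12" by simp
  also have "\<dots> \<le> G * R ^ 12" using G R12 by (intro mult_right_mono) auto
  also have "\<dots> \<le> K" by (rule K)
  finally show ?thesis .
qed

lemma K': "1 < K'" "K \<le> K'"
proof -
  have "K * 1 \<le> K * S" using K S by (intro mult_left_mono) auto
  then show "K \<le> K'" by (simp add: K'_def)
  then show "1 < K'" using K by simp
qed

lemma E: "R \<le> E" "K' powr (1 + i) \<le> E" "1 < E"
  using R powr_ge_zero[of K' "1 + i"] by (auto simp: E_def intro: less_le_trans)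

lemma T_pos: "0 < T n" using t0 S by (simp add: T_def)

lemma T_add: "T (m + l) = T m * S ^ l" by (simp add: T_def power_add)

lemma T_less_iff: "T m < T n \<longleftrightarrow> m < n" using t0 S by (simp add: T_def)

lemma T_le_iff: "T m \<le> T n \<longleftrightarrow> m \<le> n" using T_less_iff[of n m] by linarith

lemma T_powr: "T (m + l) powr (- 1 - i) = T m powr (- 1 - i) / R ^ l"
proof (induction l)
  case (Suc l)
  have "T (m + Suc l) powr (- 1 - i) = (T (m + l) * S) powr (- 1 - i)"
    by (simp add: T_def mult_ac)
  also have "\<dots> = T (m + l) powr (- 1 - i) * S powr - (1 + i)"
    using T_pos S by (simp add: powr_mult less_imp_le)
  also have "\<dots> = T m powr (- 1 - i) / R ^ Suc l"
    unfolding Suc.IH powr_minus R_def by (simp add: divide_simps)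
  finally show ?case .
qed simp

lemma I_mono: "m \<le> n \<Longrightarrow> I n \<subseteq> I m"
  using lift_Suc_antimono_le[of I, OF I_dec] .

lemma T_small: "\<eta> * T n powr - s < 1" if "\<eta> * t0 powr - s < 1" "0 < s"
proof -
  have "t0 \<le> T n" using T_le_iff[of 0 n] by (simp add: T_def)
  then have "T n powr - s \<le> t0 powr - s" using that t0 by (intro powr_mono2') auto
  then have "\<eta> * T n powr - s \<le> \<eta> * t0 powr - s" using \<eta>(1) by simp
  then show ?thesis using that by simp
qed

text \<open>A single \<open>\<eta>\<close> has to serve infinitely many line classes. The product
  \<open>D k * F k\<close> stays bounded because its exponent \<open>e - 1 + j = e - i\<close> is
  not positive; this is where \<open>e \<le> i\<close> enters.\<close>

lemma D_bounds: "0 < D k" "D k \<le> E" "D k * F k \<le> E * \<mu>"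
proof -
  have \<sigma>: "1 \<le> K * \<mu> ^ k" using K \<mu> by (simp add: one_le_power order_trans[OF _ mult_mono[of 1 K 1 "\<mu>^k"]])
  show "0 < D k" using E K \<mu> by (simp add: D_def)
  have "(K * \<mu> ^ k) powr (e - 1) \<le> (K * \<mu> ^ k) powr 0" using \<sigma> e by (intro powr_mono) auto
  then have "(K * \<mu> ^ k) powr (e - 1) \<le> 1" using K \<mu> by simp
  then show "D k \<le> E" using E by (simp add: D_def)
  have "K * \<mu> ^ Suc k = \<mu> * (K * \<mu> ^ k)" by simp
  then have "F k = \<mu> powr j * (K * \<mu> ^ k) powr j"
    using \<mu> \<sigma> by (simp only: F_def) (simp add: powr_mult)
  then have "D k * F k = E * (\<mu> powr j * (K * \<mu> ^ k) powr (e - 1 + j))"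
    by (simp add: D_def powr_add)
  moreover have "(K * \<mu> ^ k) powr (e - 1 + j) \<le> (K * \<mu> ^ k) powr 0"
    using \<sigma> e ij by (intro powr_mono) auto
  then have "(K * \<mu> ^ k) powr (e - 1 + j) \<le> 1" using K \<mu> by simp
  moreover have "\<mu> powr j \<le> \<mu>" using powr_mono[of j 1 \<mu>] \<mu> ij by simp
  ultimately show "D k * F k \<le> E * \<mu>"
    using E \<mu> mult_mono[of "\<mu> powr j" \<mu> "(K * \<mu> ^ k) powr (e - 1 + j)" 1] by simp
qed

section \<open>Avoidance of announced centres and exclusion of short vectors\<close>

lemma centre_unique:
  assumes nv: "\<And>x. x \<in> I m \<Longrightarrow> \<not> short_vec i j a b \<eta> (T m) x"
    and nc: "\<And>x. x \<in> I m \<Longrightarrow> \<not> short_covec i j a b \<eta> (T m) x"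
    and X: "X \<in> I m" "centre i j a b \<gamma> \<delta> \<eta> \<kappa> K' D F k (T m) X"
    and X': "X' \<in> I m" "centre i j a b \<gamma> \<delta> \<eta> \<kappa> K' D F k (T m) X'"
  shows "X = X'"
proof -
  have near: "\<bar>X - X'\<bar> \<le> T m powr (- 1 - i)" using I_diam X X' by blast
  consider "k = 0" | "k = 1" | "k \<noteq> 0" "k \<noteq> 1" by blast
  then show ?thesis
  proof cases
    case 1
    then show ?thesis
      using homogeneous_centre_unique[OF ij(3) T_pos \<eta>(1,3) _ _ _ near nc[OF X(1)]] X X' K'
      by (simp add: centre_def)
  next
    case 2
    have "0 < \<kappa>" "2 * \<kappa> * K' \<le> \<eta>" using \<eta> K' by (simp_all add: \<kappa>_def)
    with 2 show ?thesis
      using inhomogeneous_centre_unique[OF T_pos _ _ _ _ _ near nv[OF X(1)]] X X' K'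
      by (simp add: centre_def)
  next
    case 3
    let ?k = "k - 2"
    have E1: "E\<^sup>2 \<le> E\<^sup>2 * \<mu>" "E * \<mu> \<le> E\<^sup>2 * \<mu>"
      using E \<mu> mult_mono[of 1 E 1 \<mu>] by (auto simp: power2_eq_square)
    have "\<eta> * (D ?k)\<^sup>2 \<le> \<eta> * E\<^sup>2"
      using D_bounds[of ?k] \<eta> by (intro mult_left_mono power_mono) auto
    also have "\<dots> \<le> \<eta> * (E\<^sup>2 * \<mu>)" using E1(1) \<eta>(1) by (intro mult_left_mono) auto
    also have "\<dots> \<le> 1" using \<eta>(1,4) mult_pos_pos[of \<eta> "E\<^sup>2 * \<mu>"] \<mu> E by simp
    finally have 4: "\<eta> * (D ?k)\<^sup>2 \<le> 1" .
    have "2 * \<eta> * D ?k * F ?k \<le> 2 * \<eta> * (E * \<mu>)"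
      using D_bounds(3)[of ?k] \<eta>(1) by simp
    also have "\<dots> \<le> 2 * \<eta> * (E\<^sup>2 * \<mu>)" using E1(2) \<eta>(1) by (intro mult_left_mono) auto
    also have "\<dots> \<le> 1" using \<eta>(4) by (simp add: mult.assoc)
    finally have 5: "2 * \<eta> * D ?k * F ?k \<le> 1" .
    have "0 < F ?k" using K \<mu> by (simp add: F_def)
    then show ?thesis
      using line_centre_unique[OF ij(3) T_pos \<eta>(1) D_bounds(1) 5 4 _ _ _ near nv[OF X(1)]] X X' 3
      by (simp add: centre_def)
  qed
qed

text \<open>Being unique, the centre has left \<open>I (m + l)\<close>. One further round turns this
  exclusion into a distance, through the middle-half move.\<close>

lemma centre_avoided:
  assumes "\<And>x. x \<in> I m \<Longrightarrow> \<not> short_vec i j a b \<eta> (T m) x"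
    and "\<And>x. x \<in> I m \<Longrightarrow> \<not> short_covec i j a b \<eta> (T m) x"
    and X: "centre i j a b \<gamma> \<delta> \<eta> \<kappa> K' D F k (T m) X"
    and l: "k + 9 \<le> l" and x: "x \<in> I (m + l + 1)"
  shows "T m powr (- 1 - i) / R ^ l \<le> G * \<bar>x - X\<bar>"
proof -
  have "X \<notin> I (m + l)"
  proof
    assume *: "X \<in> I (m + l)"
    then have "X \<in> I m" using I_mono[of m "m + l"] by auto
    then have "X \<notin> I (m + k + 9)"
      using centre_unique[OF assms(1,2)] X by (intro I_avoid) auto
    then show False using * I_mono[of "m + k + 9" "m + l"] l by auto
  qed
  then show ?thesis using I_far[of X "m + l" x] x T_powr by simp
qed

text \<open>Rational and shifted points are treated together, with \<open>H = q / \<theta>\<close>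
  as the time of the point. It is announced in a round \<open>m\<close> with
  \<open>K * T m \<le> H < K * T (Suc m)\<close>. As \<open>K \<ge> S ^ 12\<close>, at least twelve
  rounds then remain, more than classes 0 and 1 need. Short vectors are excluded only before round
  \<open>n\<close>, so that the lemma can serve in the induction.\<close>

lemma point_avoided:
  fixes p p' q :: int
  assumes nv: "\<And>m x. m < n \<Longrightarrow> x \<in> I m \<Longrightarrow> \<not> short_vec i j a b \<eta> (T m) x"
    and nc: "\<And>m x. m < n \<Longrightarrow> x \<in> I m \<Longrightarrow> \<not> short_covec i j a b \<eta> (T m) x"
    and q: "1 \<le> q" and \<theta>: "0 < \<theta>" "K * t0 \<le> of_int q / \<theta>" "of_int q / \<theta> \<le> T n"
    and h: "\<bar>of_int q * b + a * (of_int p + g) - d - of_int p'\<bar> \<le> \<theta> * (of_int q / \<theta>) powr - j"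
    and x: "x \<in> I n"
    and k: "k \<le> 1" "\<And>t X. centre i j a b \<gamma> \<delta> \<eta> \<kappa> K' D F k t X \<longleftrightarrow> point_centre j a b g d \<theta> K' t X"
  shows "(of_int q / \<theta>) powr (- 1 - i) < \<bar>x - (of_int p + g) / of_int q\<bar>"
proof (rule ccontr)
  define H where "H = of_int q / \<theta>"
  define X where "X = (of_int p + g) / of_int q"
  assume "\<not> ?thesis"
  then have xX: "\<bar>x - X\<bar> \<le> H powr (- 1 - i)" by (simp add: H_def X_def)
  obtain m where m: "K * T m \<le> H" "\<not> K * T (Suc m) \<le> H"
  proof (rule geometric_last[where P = "\<lambda>m. K * T m \<le> H" and c = "K * t0" and S = S and H = H])
    show "0 < K * t0" using K t0 by simp
  qed (use S \<theta>(2) in \<open>auto simp: T_def H_def mult.assoc\<close>)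
  have H: "0 < H" using q \<theta>(1) by (simp add: H_def)
  have TH: "T m \<le> H" using m(1) K T_pos[of m] by (smt (verit) mult_le_cancel_right1)
  have "of_int q = \<theta> * H" using \<theta>(1) by (simp add: H_def)
  also have "\<dots> \<le> \<theta> * (K * T (Suc m))" using m(2) \<theta>(1) by simp
  also have "\<dots> = \<theta> * K' * T m" by (simp add: T_def K'_def)
  finally have 1: "of_int q \<le> \<theta> * K' * T m" .
  have "H powr - j \<le> T m powr - j" using TH T_pos[of m] ij by (intro powr_mono2') auto
  then have "\<theta> * H powr - j \<le> \<theta> * T m powr - j" using \<theta>(1) by simp
  then have c: "centre i j a b \<gamma> \<delta> \<eta> \<kappa> K' D F k (T m) X"
    unfolding k(2) point_centre_def X_def using 1 q order_trans[OF h] unfolding H_def by blast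
  have "T (m + 12) \<le> K * T m" unfolding T_add using S12 T_pos[of m] by (simp add: mult.commute)
  also have "\<dots> \<le> T n" using m(1) \<theta>(3) by (simp add: H_def)
  finally have mn: "m + 12 \<le> n" unfolding T_le_iff .
  have "T m powr (- 1 - i) / R ^ 10 \<le> G * \<bar>x - X\<bar>"
  proof (rule centre_avoided[OF _ _ c])
    show "x \<in> I (m + 10 + 1)" using x I_mono[of "m + 10 + 1" n] mn by auto
  qed (use nv nc mn k in auto)
  also have "\<dots> \<le> G * (K * T m) powr (- 1 - i)"
  proof -
    have "H powr (- 1 - i) \<le> (K * T m) powr (- 1 - i)"
      using m(1) K T_pos[of m] ij by (intro powr_mono2') auto
    then show ?thesis using xX G by simp
  qed
  also have "\<dots> = G * K powr (- 1 - i) * T m powr (- 1 - i)"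
    using K T_pos[of m] by (simp add: powr_mult)
  finally have "T m powr (- 1 - i) * (1 / R ^ 10) \<le> T m powr (- 1 - i) * (G * K powr (- 1 - i))"
    by (simp add: mult_ac)
  \<comment> \<open>In units of the length of \<open>I m\<close>, the distance is at least
    \<open>1 / (G * R ^ 10)\<close> by avoidance and at most \<open>1 / K\<close> by assumption,
    while \<open>K \<ge> G * R ^ 12\<close>.\<close>
  then have "1 / R ^ 10 \<le> G * K powr (- 1 - i)"
    using T_pos[of m] by (subst (asm) mult_le_cancel_left_pos) auto
  also have "\<dots> \<le> G * K powr - 1" using K ij G by (intro mult_left_mono powr_mono) auto
  also have "\<dots> \<le> G * (1 / (G * R ^ 12))"
    using K GR12 G by (intro mult_left_mono) (auto simp: powr_minus_divide intro!: divide_left_mono mult_pos_pos)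
  also have "\<dots> = 1 / R ^ 12" using G by simp
  also have "\<dots> < 1 / R ^ 10"
    using R by (intro divide_strict_left_mono power_strict_increasing) auto
  finally show False by simp
qed

text \<open>This is where the Diophantine condition acts. If \<open>l\<close> were very small, then
  \<open>C + B b\<close>, being close to \<open>- l x\<close> with \<open>x\<close> bounded, would
  be small too. Since \<open>\<bar>B\<bar> \<le> H powr j\<close>, the condition bounds
  \<open>\<bar>l\<bar>\<close> below by a multiple of \<open>H powr (2 * e - 1)\<close>, so the
  radius \<open>\<eta> / (H * \<bar>l\<bar>)\<close> is at most a multiple of
  \<open>H powr (- 2 * e)\<close>.\<close>

lemma line_height:
  fixes A B C :: int
  assumes ABC: "\<not> (A = 0 \<and> B = 0 \<and> C = 0)" and x: "x \<in> I n"
    and l_def: "l = of_int A + of_int B * a" and H_def: "H = max ((\<bar>l\<bar> / \<eta>) powr (1 / i)) ((\<bar>of_int B\<bar> / \<eta>) powr (1 / j))"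
    and H: "H \<le> T n"
    and small: "\<bar>l * x + (of_int C + of_int B * b)\<bar> \<le> \<eta> * T n powr - 1"
  shows "l \<noteq> 0" "1 / \<eta> \<le> H" "\<eta> / \<bar>l\<bar> \<le> H powr (1 - 2 * e) / c1"
proof -
  have c1: "0 < c1" "c1 \<le> 1" "c1 \<le> c0 / (2 * (1 + x0))" using c0 x0 by (auto simp: c1_def)
  have inv: "1 / \<eta> \<le> (y / \<eta>) powr (1 / s)" if "1 \<le> y" "0 < s" "s \<le> 1" for y s :: real
  proof -
    have \<eta>1: "1 \<le> 1 / \<eta>" using \<eta> by simp
    have "1 / \<eta> \<le> (1 / \<eta>) powr (1 / s)"
      using that powr_mono[of 1 "1 / s" "1 / \<eta>"] \<eta>1 \<eta>(1) by simp
    also have "\<dots> \<le> (y / \<eta>) powr (1 / s)"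
      using that \<eta>(1) by (intro powr_mono2) (auto intro!: divide_right_mono)
    finally show ?thesis .
  qed
  have "l \<noteq> 0 \<and> 1 / \<eta> \<le> H \<and> \<eta> / \<bar>l\<bar> \<le> H powr (1 - 2 * e) / c1"
  proof (cases "B = 0")
    case True
    then have l: "l = of_int A" by (simp add: l_def)
    have "A \<noteq> 0"
    proof
      assume "A = 0"
      then have "\<bar>real_of_int C\<bar> < 1"
        using small True l T_small[OF \<eta>(7), of n] by simp
      then have "C = 0" by linarith
      then show False using ABC True \<open>A = 0\<close> by simp
    qed
    then have l1: "1 \<le> \<bar>l\<bar>" unfolding l by linarith
    have H1: "1 / \<eta> \<le> H" using inv[OF l1 ij(2)] i_less by (simp add: H_def)
    moreover have "1 \<le> 1 / \<eta>" using \<eta> by simp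
    ultimately have "1 \<le> H" by linarith
    then have "1 \<le> H powr (1 - 2 * e)" using e by (intro ge_one_powr_ge_zero) auto
    then have "1 \<le> H powr (1 - 2 * e) / c1" using c1 by (simp add: le_divide_eq)
    moreover have "\<eta> / \<bar>l\<bar> \<le> 1" using \<eta> l1 by (simp add: divide_le_eq)
    ultimately have "\<eta> / \<bar>l\<bar> \<le> H powr (1 - 2 * e) / c1" by linarith
    then show ?thesis using H1 l1 by auto
  next
    case False
    define s where "s = (1 - 2 * e) / j"
    have s: "0 < s" "s \<le> 1 / j" "j * s = 1 - 2 * e" using e ij by (auto simp: s_def divide_right_mono)
    define y where "y = \<bar>real_of_int B\<bar>"
    have y: "1 \<le> y" using False unfolding y_def by linarith
    have j1: "j \<le> 1" using ij by simp
    have H1: "1 / \<eta> \<le> H" using inv[OF y ij(1) j1] by (simp add: H_def y_def)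
    have "1 \<le> 1 / \<eta>" using \<eta> by simp
    then have H_pos: "1 \<le> H" using H1 by linarith
    have yH: "y \<le> \<eta> * H powr j"
    proof -
      have "y / \<eta> = ((y / \<eta>) powr (1 / j)) powr j"
        using y \<eta>(1) ij by (simp add: powr_powr)
      also have "\<dots> \<le> H powr j" using ij by (intro powr_mono2) (auto simp: H_def y_def)
      finally show ?thesis using \<eta>(1) by (simp add: divide_le_eq mult.commute)
    qed
    have "\<eta> * H powr j \<le> 1 * H powr j" using \<eta> by (intro mult_right_mono) auto
    then have "y \<le> H powr j" using yH by simp
    then have "y powr s \<le> (H powr j) powr s" using y s by (intro powr_mono2) auto
    then have ys: "y powr s \<le> H powr (1 - 2 * e)" by (simp add: powr_powr s(3))
    have "y powr s \<le> H powr 1"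
      using ys powr_mono[of "1 - 2 * e" 1 H] e H_pos by linarith
    then have "H powr - 1 \<le> y powr - s"
      using y H_pos by (simp add: powr_minus_divide divide_simps)
    moreover have "T n powr - 1 \<le> H powr - 1" using H H_pos by (intro powr_mono2') auto
    \<comment> \<open>The error allowed by the short covector is at most half of the Diophantine
      lower bound. The other half has to come from \<open>l\<close>, either directly or through
      \<open>l * x\<close>.\<close>
    ultimately have "\<eta> * T n powr - 1 \<le> (c0 / 2) * y powr - s"
      using \<eta>(1,9) by (intro mult_mono) auto
    moreover have "\<bar>l * x\<bar> \<le> \<bar>l\<bar> * x0"
      using I_bounded[of x] x I_mono[of 0 n] by (auto simp: abs_mult intro!: mult_left_mono)
    ultimately have "\<bar>of_int C + of_int B * b\<bar> \<le> \<bar>l\<bar> * x0 + (c0 / 2) * y powr - s"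
      using small by linarith
    moreover have "c0 * y powr - s \<le> max \<bar>l\<bar> \<bar>of_int C + of_int B * b\<bar>"
      using dioph[OF False] unfolding l_def y_def s_def .
    moreover have "0 \<le> \<bar>l\<bar> * x0" "0 \<le> (c0 / 2) * y powr - s" using x0 c0 by auto
    ultimately have "(c0 / 2) * y powr - s \<le> \<bar>l\<bar> * (1 + x0)"
      by (auto simp: algebra_simps max_def split: if_splits)
    then have "c0 / (2 * (1 + x0)) * y powr - s \<le> \<bar>l\<bar>" using x0 by (simp add: field_simps)
    moreover have "c1 * y powr - s \<le> c0 / (2 * (1 + x0)) * y powr - s"
      using c1 by (intro mult_right_mono) auto
    ultimately have l1: "c1 * y powr - s \<le> \<bar>l\<bar>" by linarith
    have l2: "0 < c1 * y powr - s" using c1 y by simp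
    have "\<eta> / \<bar>l\<bar> \<le> 1 / (c1 * y powr - s)"
      using \<eta> l1 l2 by (intro frac_le) auto
    also have "\<dots> = y powr s / c1" using y by (simp add: powr_minus_divide)
    also have "\<dots> \<le> H powr (1 - 2 * e) / c1" using ys c1 by (intro divide_right_mono) auto
    finally show ?thesis using H1 l1 l2 by auto
  qed
  then show "l \<noteq> 0" "1 / \<eta> \<le> H" "\<eta> / \<bar>l\<bar> \<le> H powr (1 - 2 * e) / c1" by auto
qed

text \<open>A short covector at \<open>x\<close> is a line whose forbidden interval, of radius
  \<open>\<rho>\<close> around \<open>X\<close>, contains \<open>x\<close>. Its centre was announced
  in an earlier round and has been left behind far enough to contradict this.\<close>

lemma no_short_covec:
  assumes nv: "\<And>m x. m < n \<Longrightarrow> x \<in> I m \<Longrightarrow> \<not> short_vec i j a b \<eta> (T m) x"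
    and nc: "\<And>m x. m < n \<Longrightarrow> x \<in> I m \<Longrightarrow> \<not> short_covec i j a b \<eta> (T m) x"
    and x: "x \<in> I n"
  shows "\<not> short_covec i j a b \<eta> (T n) x"
proof
  assume "short_covec i j a b \<eta> (T n) x"
  then obtain A B C :: int where ABC: "\<not> (A = 0 \<and> B = 0 \<and> C = 0)"
    and A: "\<bar>of_int A + of_int B * a\<bar> \<le> \<eta> * T n powr i" and B: "\<bar>real_of_int B\<bar> \<le> \<eta> * T n powr j"
    and C: "\<bar>(of_int A + of_int B * a) * x + (of_int C + of_int B * b)\<bar> \<le> \<eta> * T n powr - 1"
    unfolding short_covec_def by blast
  define l where "l = of_int A + of_int B * a"
  define H where "H = max ((\<bar>l\<bar> / \<eta>) powr (1 / i)) ((\<bar>of_int B\<bar> / \<eta>) powr (1 / j))"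
  define X where "X = - (of_int C + of_int B * b) / l"
  define \<rho> where "\<rho> = \<eta> / (H * \<bar>l\<bar>)"
  have le_T: "(\<bar>y\<bar> / \<eta>) powr (1 / s) \<le> T n" if "\<bar>y\<bar> \<le> \<eta> * T n powr s" "0 < s" for y s
  proof -
    have "\<bar>y\<bar> / \<eta> \<le> T n powr s" using that \<eta>(1) by (simp add: divide_le_eq mult.commute)
    then have "(\<bar>y\<bar> / \<eta>) powr (1 / s) \<le> (T n powr s) powr (1 / s)"
      using that \<eta>(1) by (intro powr_mono2) auto
    then show ?thesis using that T_pos[of n] by (simp add: powr_powr)
  qed
  have HT: "H \<le> T n" using le_T A B ij by (auto simp: H_def l_def)
  have C': "\<bar>l * x + (of_int C + of_int B * b)\<bar> \<le> \<eta> * T n powr - 1" using C by (simp add: l_def)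
  note height = line_height[OF ABC x l_def H_def HT C']
  have le_H: "\<bar>y\<bar> \<le> \<eta> * H powr s" if "(\<bar>y\<bar> / \<eta>) powr (1 / s) \<le> H" "0 < s" for y s
  proof -
    have "\<bar>y\<bar> / \<eta> = ((\<bar>y\<bar> / \<eta>) powr (1 / s)) powr s" using that \<eta>(1) by (simp add: powr_powr)
    also have "\<dots> \<le> H powr s" using that by (intro powr_mono2) auto
    finally show ?thesis using \<eta>(1) by (simp add: divide_le_eq mult.commute)
  qed
  have H_ge: "(\<bar>l\<bar> / \<eta>) powr (1 / i) \<le> H" "(\<bar>of_int B\<bar> / \<eta>) powr (1 / j) \<le> H"
    unfolding H_def by (rule max.cobounded1 max.cobounded2)+
  have AH: "\<bar>l\<bar> \<le> \<eta> * H powr i" and BH: "\<bar>real_of_int B\<bar> \<le> \<eta> * H powr j"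
    using le_H[OF H_ge(1) ij(2)] le_H[OF H_ge(2) ij(1)] .
  have "0 < 1 / \<eta>" using \<eta>(1) by simp
  then have H: "0 < H" using height(2) by linarith
  have l: "0 < \<bar>l\<bar>" using height(1) by simp
  have xX: "\<bar>x - X\<bar> \<le> \<rho>"
  proof -
    have "x - X = (l * x + (of_int C + of_int B * b)) / l"
      using l by (simp add: X_def field_simps)
    then have "\<bar>x - X\<bar> = \<bar>l * x + (of_int C + of_int B * b)\<bar> / \<bar>l\<bar>" by (simp only: abs_divide)
    also have "\<dots> \<le> (\<eta> * T n powr - 1) / \<bar>l\<bar>" using C' by (intro divide_right_mono) auto
    also have "\<dots> \<le> (\<eta> * H powr - 1) / \<bar>l\<bar>"
      using HT H \<eta>(1) by (intro divide_right_mono mult_left_mono powr_mono2') auto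
    also have "\<dots> = \<rho>" using H by (simp add: \<rho>_def powr_minus_divide)
    finally show ?thesis .
  qed
  obtain m where m: "\<rho> \<le> T m powr (- 1 - i) * (T m / H) powr e" "K * T m \<le> H"
    and m': "\<not> (\<rho> \<le> T (Suc m) powr (- 1 - i) * (T (Suc m) / H) powr e \<and> K * T (Suc m) \<le> H)"
  proof (rule geometric_last[where c = "K * t0" and S = S and H = H
      and P = "\<lambda>m. \<rho> \<le> T m powr (- 1 - i) * (T m / H) powr e \<and> K * T m \<le> H"])
    show "0 < K * t0" "1 < S" using K t0 S by auto
    show "K * t0 * S ^ m \<le> H" if "\<rho> \<le> T m powr (- 1 - i) * (T m / H) powr e \<and> K * T m \<le> H" for m
      using that by (simp add: T_def mult.assoc)
    have c1: "0 < c1" using c0 x0 by (auto simp: c1_def)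
    have "K * t0 \<le> 1 / \<eta>" using \<eta>(1,8) by (simp add: le_divide_eq)
    then have 1: "K * T 0 \<le> H" using height(2) by (simp add: T_def)
    have "H powr - e \<le> (1 / \<eta>) powr - e" using height(2) \<eta>(1) e by (intro powr_mono2') auto
    also have "\<dots> = \<eta> powr e" using \<eta>(1) by (simp add: powr_minus powr_divide)
    finally have He: "H powr - e \<le> c1 * (t0 powr (- 1 - i) * t0 powr e)" using \<eta>(10) by simp
    have "\<rho> = \<eta> / \<bar>l\<bar> * H powr - 1" using H by (simp add: \<rho>_def powr_minus_divide)
    also have "\<dots> \<le> H powr (1 - 2 * e) / c1 * H powr - 1" by (intro mult_right_mono height(3)) auto
    \<comment> \<open>The saving \<open>H powr (- 2 * e)\<close> is shared out: one factor goes into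
      \<open>(T 0 / H) powr e\<close>, the other is beaten by the choice of \<open>\<eta>\<close>,
      because \<open>H \<ge> 1 / \<eta>\<close>.\<close>
    also have "\<dots> = H powr - e * (H powr - e / c1)"
    proof -
      have "H powr (1 - 2 * e) * H powr - 1 = H powr - e * H powr - e"
        unfolding powr_add[symmetric] by simp
      then show ?thesis by (simp only: times_divide_eq_left times_divide_eq_right)
    qed
    also have "\<dots> \<le> H powr - e * (t0 powr (- 1 - i) * t0 powr e)"
      using He c1 by (intro mult_left_mono) (auto simp: divide_le_eq mult.commute)
    also have "\<dots> = T 0 powr (- 1 - i) * (T 0 / H) powr e"
      using H t0 by (simp add: T_def powr_divide powr_minus_divide)
    finally show "\<rho> \<le> T 0 powr (- 1 - i) * (T 0 / H) powr e \<and> K * T 0 \<le> H" using 1 by simp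
  qed blast
  define \<tau> where "\<tau> = H / T m"
  have H_eq: "H = T m * \<tau>" using T_pos[of m] by (simp add: \<tau>_def)
  have \<tau>K: "K \<le> \<tau>" using m(2) T_pos[of m] by (simp add: \<tau>_def le_divide_eq)
  have \<tau>: "1 < \<tau>" using \<tau>K K by simp
  obtain k where k: "K * \<mu> ^ k \<le> \<tau>" "\<not> K * \<mu> ^ Suc k \<le> \<tau>"
    using geometric_last[of K \<mu> "\<lambda>k. K * \<mu> ^ k \<le> \<tau>" \<tau>] K \<mu> \<tau>K by auto
  have \<mu>k: "0 < \<mu> ^ k" using \<mu> by simp
  \<comment> \<open>Round \<open>m + 1\<close> fails for one of two reasons. Either
    \<open>H < K * T (Suc m)\<close>, and then \<open>\<tau> \<le> K'\<close> and the trivial bound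
    on \<open>l\<close> suffices; or the radius is too large for that round, which bounds
    \<open>\<bar>l\<bar>\<close> from above. The two cases account for the two summands of
    \<open>E\<close>.\<close>
  have l_le: "\<bar>l\<bar> \<le> \<eta> * E * T m powr i * \<tau> powr (e - 1)"
  proof (cases "K * T (Suc m) \<le> H")
    case False
    have "H < K' * T m" using False by (simp add: K'_def T_def mult_ac)
    then have "\<tau> \<le> K'" using T_pos[of m] by (simp add: \<tau>_def divide_le_eq)
    then have "\<tau> powr (1 + i - e) \<le> K' powr (1 + i - e)" using \<tau> e ij by (intro powr_mono2) auto
    also have "\<dots> \<le> K' powr (1 + i)" using K' e by (intro powr_mono) auto
    finally have "\<tau> powr (1 + i - e) \<le> E" using E by linarith
    then have "\<tau> powr (1 + i - e) * (\<eta> * T m powr i * \<tau> powr (e - 1)) \<le> E * (\<eta> * T m powr i * \<tau> powr (e - 1))"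
      using \<eta>(1) by (intro mult_right_mono) auto
    moreover have "H powr i = T m powr i * (\<tau> powr (1 + i - e) * \<tau> powr (e - 1))"
      unfolding H_eq using T_pos[of m] \<tau> by (simp add: powr_mult powr_add[symmetric])
    ultimately show ?thesis using AH by (simp add: mult_ac)
  next
    case True
    have T1: "T (Suc m) powr (- 1 - i) = T m powr (- 1 - i) / R" using T_powr[of m 1] by simp
    have "(T m / H) powr e \<le> (T (Suc m) / H) powr e"
      using H T_pos[of m] e T_le_iff[of m "Suc m"] by (intro powr_mono2) (auto intro!: divide_right_mono)
    then have "T m powr (- 1 - i) / R * (T m / H) powr e \<le> T m powr (- 1 - i) / R * (T (Suc m) / H) powr e"
      using R by (intro mult_left_mono) auto
    also have "\<dots> < \<rho>" using m' True T1 by simp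
    finally have "T m powr (- 1 - i) / R * (T m / H) powr e < \<eta> / (H * \<bar>l\<bar>)" by (simp add: \<rho>_def)
    moreover have "(T m / H) powr e = \<tau> powr - e"
      unfolding H_eq using T_pos[of m] \<tau> by (simp add: powr_divide powr_minus_divide)
    moreover have "T m powr (- 1 - i) = 1 / (T m * T m powr i)"
      using T_pos[of m] by (simp add: powr_diff powr_minus_divide)
    ultimately have "1 / (T m * T m powr i) / R * \<tau> powr - e < \<eta> / (H * \<bar>l\<bar>)" by simp
    then have "\<bar>l\<bar> * H * \<tau> powr - e < \<eta> * R * (T m * T m powr i)"
      using l H R T_pos[of m] by (simp add: field_simps)
    then have "\<bar>l\<bar> * (\<tau> * \<tau> powr - e) < \<eta> * R * T m powr i"
      unfolding H_eq using T_pos[of m] by (simp add: mult_ac)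
    then have "\<bar>l\<bar> * (\<tau> * \<tau> powr - e) * \<tau> powr (e - 1) \<le> \<eta> * R * T m powr i * \<tau> powr (e - 1)"
      by (intro mult_right_mono) auto
    moreover have "\<tau> * \<tau> powr - e * \<tau> powr (e - 1) = 1"
      using \<tau> by (simp add: powr_mult_base powr_add[symmetric])
    ultimately have "\<bar>l\<bar> \<le> \<eta> * R * T m powr i * \<tau> powr (e - 1)" by (simp add: mult.assoc)
    also have "\<dots> \<le> \<eta> * E * T m powr i * \<tau> powr (e - 1)"
      using E(1) \<eta>(1) by (intro mult_right_mono mult_left_mono) auto
    finally show ?thesis .
  qed
  \<comment> \<open>The bound on \<open>l\<close> decreases with \<open>\<tau>\<close> and that on
    \<open>B\<close> increases, so \<open>D k\<close> is taken at the lower end of the range of the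
    class and \<open>F k\<close> at the upper end.\<close>
  have "\<tau> powr (e - 1) \<le> (K * \<mu> ^ k) powr (e - 1)"
    using k(1) K \<mu>k e by (intro powr_mono2') auto
  then have "\<eta> * E * T m powr i * \<tau> powr (e - 1) \<le> \<eta> * E * T m powr i * (K * \<mu> ^ k) powr (e - 1)"
    using \<eta>(1) E by (intro mult_left_mono) auto
  then have l_box: "\<bar>l\<bar> \<le> \<eta> * D k * T m powr i" using l_le by (simp add: D_def mult_ac)
  have "\<tau> powr j \<le> F k" using k(2) \<tau> ij unfolding F_def by (intro powr_mono2) auto
  then have "\<eta> * (T m powr j * \<tau> powr j) \<le> \<eta> * (T m powr j * F k)"
    using \<eta>(1) by (intro mult_left_mono) auto
  moreover have "H powr j = T m powr j * \<tau> powr j"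
    unfolding H_eq using T_pos[of m] \<tau> by (simp add: powr_mult)
  ultimately have B_box: "\<bar>real_of_int B\<bar> \<le> \<eta> * F k * T m powr j" using BH by (simp add: mult_ac)
  have c: "centre i j a b \<gamma> \<delta> \<eta> \<kappa> K' D F (k + 2) (T m) X"
    using l_box B_box height(1) unfolding centre_def line_centre_def X_def l_def by auto
  \<comment> \<open>The ratio \<open>\<tau>\<close> leaves \<open>k + 12\<close> rounds: class
    \<open>k + 2\<close> is removed within \<open>k + 11\<close>, and one more provides the
    distance.\<close>
  have "T (m + (k + 12)) \<le> T n"
  proof -
    have "S ^ k \<le> \<mu> ^ k" using S R \<mu> by (intro power_mono) auto
    then have "S ^ (k + 12) \<le> K * \<mu> ^ k"
      using S S12 K mult_mono[of "S^12" K "S ^ k" "\<mu> ^ k"] by (simp add: power_add mult.commute)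
    then have "S ^ (k + 12) \<le> \<tau>" using k(1) by linarith
    then have "T (m + (k + 12)) \<le> H" unfolding T_add H_eq using T_pos[of m] by (intro mult_left_mono) auto
    then show ?thesis using HT by linarith
  qed
  then have mn: "m + (k + 12) \<le> n" unfolding T_le_iff .
  have "T m powr (- 1 - i) / R ^ (k + 11) \<le> G * \<bar>x - X\<bar>"
  proof (rule centre_avoided[OF _ _ c])
    show "x \<in> I (m + (k + 11) + 1)" using x I_mono[of "m + (k + 11) + 1" n] mn by auto
  qed (use nv nc mn in auto)
  also have "\<dots> \<le> G * (T m powr (- 1 - i) * (T m / H) powr e)"
    using xX m(1) G by (intro mult_left_mono) auto
  also have "(T m / H) powr e = 1 / \<tau> powr e"
    unfolding H_eq using T_pos[of m] \<tau> by (simp add: powr_divide)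
  finally have "T m powr (- 1 - i) / R ^ (k + 11) \<le> T m powr (- 1 - i) * (G / \<tau> powr e)" by (simp add: mult_ac)
  then have 1: "\<tau> powr e \<le> G * R ^ (k + 11)"
    using T_pos[of m] R \<tau> by (simp add: field_simps)
  \<comment> \<open>By the choice of \<open>K\<close> and \<open>\<mu>\<close>,
    \<open>(K * \<mu> ^ k) powr e = G * R ^ (k + 12)\<close>, one factor \<open>R\<close> more than
    the bound just obtained for \<open>\<tau> powr e\<close> permits.\<close>
  have "\<mu> ^ k = (R ^ k) powr (1 / e)"
    using R by (simp add: \<mu>_def powr_powr powr_realpow[symmetric] mult.commute)
  then have "K * \<mu> ^ k = (G * R ^ 12 * R ^ k) powr (1 / e)"
    using R G by (simp add: K_def powr_mult)
  then have "(K * \<mu> ^ k) powr e = G * R ^ 12 * R ^ k"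
    using e R G by (simp add: powr_powr)
  moreover have "(K * \<mu> ^ k) powr e \<le> \<tau> powr e" using k(1) K \<mu>k e by (intro powr_mono2) auto
  ultimately have "G * R ^ (k + 12) \<le> G * R ^ (k + 11)" using 1 by (simp add: power_add mult_ac)
  then have "R ^ (k + 12) \<le> R ^ (k + 11)" using G by simp
  then show False using R by (simp add: power_increasing_iff)
qed

text \<open>A vector with \<open>q = 0\<close> would have entries below 1 by the choice of
  \<open>\<eta>\<close> and hence vanish. Otherwise, up to sign, it is a rational point whose time
  \<open>q / \<eta>\<close> is at most \<open>T n\<close> and which is closer to \<open>x\<close>
  than \<open>point_avoided\<close> allows.\<close>

lemma no_short_vec:
  assumes nv: "\<And>m x. m < n \<Longrightarrow> x \<in> I m \<Longrightarrow> \<not> short_vec i j a b \<eta> (T m) x"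
    and nc: "\<And>m x. m < n \<Longrightarrow> x \<in> I m \<Longrightarrow> \<not> short_covec i j a b \<eta> (T m) x"
    and x: "x \<in> I n"
  shows "\<not> short_vec i j a b \<eta> (T n) x"
proof
  assume "short_vec i j a b \<eta> (T n) x"
  then obtain p1 p2 q :: int where nz: "\<not> (p1 = 0 \<and> p2 = 0 \<and> q = 0)"
    and q: "\<bar>of_int q\<bar> \<le> \<eta> * T n" and p1: "\<bar>of_int q * x - of_int p1\<bar> \<le> \<eta> * T n powr - i"
    and p2: "\<bar>of_int q * b + a * of_int p1 - of_int p2\<bar> \<le> \<eta> * T n powr - j"
    unfolding short_vec_def by blast
  have no: False
    if q0: "1 \<le> r" and q: "of_int r \<le> \<eta> * T n" and p1: "\<bar>of_int r * x - of_int r1\<bar> \<le> \<eta> * T n powr - i"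
      and p2: "\<bar>of_int r * b + a * of_int r1 - of_int r2\<bar> \<le> \<eta> * T n powr - j" for r r1 r2 :: int
  proof -
    define H where "H = of_int r / \<eta>"
    have r1: "1 \<le> real_of_int r" using q0 by simp
    have H: "0 < H" "H \<le> T n" "of_int r = \<eta> * H" using r1 q \<eta>(1) by (auto simp: H_def divide_le_eq mult.commute)
    have "1 / \<eta> \<le> H" using r1 \<eta>(1) unfolding H_def by (intro divide_right_mono) auto
    moreover have "K * t0 \<le> 1 / \<eta>" using \<eta>(1,8) by (simp add: le_divide_eq)
    ultimately have HK: "K * t0 \<le> H" by linarith
    have mono: "\<eta> * T n powr - s \<le> \<eta> * H powr - s" if "0 < s" for s
      using that H \<eta>(1) by (intro mult_left_mono powr_mono2') auto
    have "H powr (- 1 - i) < \<bar>x - (of_int r1 + 0) / of_int r\<bar>"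
      unfolding H_def
    proof (rule point_avoided[where p = r1 and g = 0 and d = 0 and p' = r2 and k = 0, OF nv nc q0 \<eta>(1) _ _ _ x])
      show "\<bar>of_int r * b + a * (of_int r1 + 0) - 0 - of_int r2\<bar> \<le> \<eta> * (of_int r / \<eta>) powr - j"
        using p2 mono[OF ij(1)] by (simp add: H_def)
    qed (use H(2)[unfolded H_def] HK[unfolded H_def] in \<open>simp_all add: centre_def\<close>)
    also have "\<dots> = \<bar>of_int r * x - of_int r1\<bar> / of_int r"
      using r1 by (simp add: abs_divide field_simps)
    also have "\<dots> \<le> (\<eta> * H powr - i) / (\<eta> * H)"
      using p1 mono[OF ij(2)] r1 H(3) by (intro frac_le) auto
    also have "\<dots> = H powr (- 1 - i)"
      using H \<eta>(1) by (simp add: powr_diff powr_minus_divide)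
    finally show False by simp
  qed
  consider "q = 0" | "1 \<le> q" | "1 \<le> - q" by linarith
  then show False
  proof cases
    case 1
    then have "\<bar>real_of_int p1\<bar> < 1" using p1 T_small[OF \<eta>(5) ij(2), of n] by simp
    then have "p1 = 0" by linarith
    then have "\<bar>real_of_int p2\<bar> < 1" using 1 p2 T_small[OF \<eta>(6) ij(1), of n] by simp
    then show False using 1 \<open>p1 = 0\<close> nz by linarith
  next
    case 2
    then show False using no[OF 2, of p1 p2] q p1 p2 by auto
  next
    case 3
    have neg: "of_int (- q) * x - of_int (- p1) = - (of_int q * x - of_int p1)"
      "of_int (- q) * b + a * of_int (- p1) - of_int (- p2) = - (of_int q * b + a * of_int p1 - of_int p2)"
      by simp_all
    show False using no[OF 3, of "- p1" "- p2"] 3 q p1 p2 unfolding neg abs_minus_cancel by simp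
  qed
qed

text \<open>The two exclusions need a simultaneous induction: centres announced in a round are known
  to be unique only if both short vectors and short covectors are absent there.\<close>

lemma no_short:
  "x \<in> I n \<Longrightarrow> \<not> short_vec i j a b \<eta> (T n) x \<and> \<not> short_covec i j a b \<eta> (T n) x"
proof (induction n arbitrary: x rule: less_induct)
  case (less n)
  then show ?case using no_short_vec[of n x] no_short_covec[of n x] by blast
qed

text \<open>With short vectors excluded in all rounds, \<open>n\<close> can be taken as late as the
  time \<open>q / \<kappa>\<close> requires.\<close>

lemma inhomogeneous_avoided:
  fixes p1 p2 q :: int
  assumes x: "\<And>n. x \<in> I n" and q: "1 \<le> q"
    and h: "\<bar>of_int q * b + a * (of_int p1 + \<gamma>) - \<delta> - of_int p2\<bar> \<le> \<kappa> * (of_int q / \<kappa>) powr - j"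
  shows "(of_int q / \<kappa>) powr (- 1 - i) < \<bar>x - (of_int p1 + \<gamma>) / of_int q\<bar>"
proof -
  have \<kappa>: "0 < \<kappa>" "\<kappa> \<le> \<eta>" using \<eta>(1) K' by (auto simp: \<kappa>_def divide_le_eq)
  define H where "H = of_int q / \<kappa>"
  obtain n where "H / t0 < S ^ n" using real_arch_pow[OF S] by blast
  then have n: "of_int q / \<kappa> \<le> T n"
    unfolding H_def[symmetric] using t0 by (simp add: T_def divide_less_eq mult.commute)
  have "K * t0 \<le> 1 / \<eta>" using \<eta>(1,8) by (simp add: le_divide_eq)
  also have "\<dots> \<le> of_int q / \<kappa>" using \<kappa> q by (intro frac_le) auto
  finally have "K * t0 \<le> of_int q / \<kappa>" .
  then show ?thesis
  proof (intro point_avoided[where n = n and k = 1 and d = \<delta> and p' = p2])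
    show "\<not> short_vec i j a b \<eta> (T m) y" "\<not> short_covec i j a b \<eta> (T m) y" if "y \<in> I m" for m y
      using no_short[OF that] by blast+
    show "centre i j a b \<gamma> \<delta> \<eta> \<kappa> K' D F 1 t X \<longleftrightarrow> point_centre j a b \<gamma> \<delta> \<kappa> K' t X" for t X
      by (simp add: centre_def)
  qed (use q \<kappa>(1) n h x in simp_all)
qed

end

section \<open>From avoided shifted points to bad approximability\<close>

lemma (in nested_intervals) in_Bad_fun:
  assumes x: "\<And>n. x \<in> I n" and ji: "j \<le> i"
  shows "x \<in> Bad_fun (\<lambda>x. a * x + b) (\<gamma>, \<delta>) i j"
proof -
  have \<kappa>: "0 < \<kappa>" using \<eta>(1) K' by (simp add: \<kappa>_def)
  \<comment> \<open>The two nontrivial bounds are solved from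
    \<open>c powr i \<le> \<kappa> powr (1 + i)\<close> and
    \<open>(1 + \<bar>a\<bar>) * c powr j \<le> \<kappa> powr (1 + j)\<close>, which make a failure
    at \<open>q\<close> contradict \<open>inhomogeneous_avoided\<close>.\<close>
  define c where "c = min 1 (min ((\<kappa> powr (1 + i)) powr (1 / i)) ((\<kappa> powr (1 + j) / (1 + \<bar>a\<bar>)) powr (1 / j)))"
  have c: "0 < c" "c \<le> 1" using \<kappa> by (auto simp: c_def)
  have ci: "c powr i \<le> \<kappa> powr (1 + i)"
  proof -
    have "c powr i \<le> ((\<kappa> powr (1 + i)) powr (1 / i)) powr i"
      using c ij by (intro powr_mono2) (auto simp: c_def)
    then show ?thesis using ij \<kappa> by (simp add: powr_powr)
  qed
  have cj: "(1 + \<bar>a\<bar>) * c powr j \<le> \<kappa> powr (1 + j)"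
  proof -
    have "c powr j \<le> ((\<kappa> powr (1 + j) / (1 + \<bar>a\<bar>)) powr (1 / j)) powr j"
      using c ij by (intro powr_mono2) (auto simp: c_def)
    then have "c powr j \<le> \<kappa> powr (1 + j) / (1 + \<bar>a\<bar>)" using ij \<kappa> by (simp add: powr_powr)
    then show ?thesis by (simp add: le_divide_eq mult.commute)
  qed
  have bad: "c * inverse (real q) < max (dist_nearest_int (real q * x - \<gamma>) powr (1 / i))
         (dist_nearest_int (real q * (a * x + b) - \<delta>) powr (1 / j))" if q: "q \<ge> 1" for q :: nat
  proof (rule ccontr)
    assume neg: "\<not> ?thesis"
    define p where "p = round (real q * x - \<gamma>)"
    define p' where "p' = round (real q * (a * x + b) - \<delta>)"
    have root: "\<bar>y\<bar> \<le> (c / q) powr s" if "\<bar>y\<bar> powr (1 / s) \<le> c / q" "0 < s" for y s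
    proof -
      have "\<bar>y\<bar> = (\<bar>y\<bar> powr (1 / s)) powr s" using that by (simp add: powr_powr)
      also have "\<dots> \<le> (c / q) powr s" using that by (intro powr_mono2) auto
      finally show ?thesis .
    qed
    have d1: "\<bar>real q * x - \<gamma> - p\<bar> \<le> (c / q) powr i" and d2: "\<bar>real q * (a * x + b) - \<delta> - p'\<bar> \<le> (c / q) powr j"
    proof -
      have "\<bar>real q * x - \<gamma> - p\<bar> powr (1 / i) \<le> c / q" "\<bar>real q * (a * x + b) - \<delta> - p'\<bar> powr (1 / j) \<le> c / q"
        using neg by (auto simp: p_def p'_def dist_nearest_int_def divide_inverse not_less)
      then show "\<bar>real q * x - \<gamma> - p\<bar> \<le> (c / q) powr i" "\<bar>real q * (a * x + b) - \<delta> - p'\<bar> \<le> (c / q) powr j"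
        using root ij by blast+
    qed
    have cq: "0 < c / q" "c / q \<le> 1" using c q by (auto simp: divide_le_eq)
    \<comment> \<open>Here \<open>j \<le> i\<close> makes the shear harmless: the horizontal error,
      multiplied by \<open>a\<close>, is still of the order permitted to the vertical one.\<close>
    have "(c / q) powr i \<le> (c / q) powr j" using cq ji by (intro powr_mono') auto
    then have d3: "\<bar>a * (real q * x - \<gamma> - p)\<bar> \<le> \<bar>a\<bar> * (c / q) powr j"
      unfolding abs_mult using d1 by (intro mult_left_mono) auto
    have "real q * b + a * (p + \<gamma>) - \<delta> - p' = (real q * (a * x + b) - \<delta> - p') - a * (real q * x - \<gamma> - p)"
      by (simp add: algebra_simps)
    then have "\<bar>real q * b + a * (p + \<gamma>) - \<delta> - p'\<bar> \<le> (1 + \<bar>a\<bar>) * (c / q) powr j"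
      using d2 d3 by (simp add: algebra_simps)
    also have "\<dots> = (1 + \<bar>a\<bar>) * c powr j * q powr - j"
      using c q by (simp add: powr_divide powr_minus_divide)
    also have "\<dots> \<le> \<kappa> powr (1 + j) * q powr - j" using cj by (intro mult_right_mono) auto
    also have "\<dots> = \<kappa> * (q / \<kappa>) powr - j"
      using \<kappa> q by (simp add: powr_divide powr_minus_divide powr_add)
    finally have h: "\<bar>of_int (int q) * b + a * (of_int p + \<gamma>) - \<delta> - of_int p'\<bar> \<le> \<kappa> * (of_int (int q) / \<kappa>) powr - j"
      by simp
    have "(q / \<kappa>) powr (- 1 - i) < \<bar>x - (of_int p + \<gamma>) / q\<bar>"
      using inhomogeneous_avoided[OF x _ h] q by simp
    also have "\<dots> = \<bar>real q * x - \<gamma> - p\<bar> / q"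
    proof -
      have "x - (of_int p + \<gamma>) / q = (real q * x - \<gamma> - p) / q" using q by (simp add: field_simps)
      then show ?thesis by simp
    qed
    also have "\<dots> \<le> (c / q) powr i / q" using d1 by (intro divide_right_mono) auto
    also have "\<dots> = c powr i * q powr (- 1 - i)"
      using c q by (simp add: powr_divide powr_diff powr_minus_divide)
    also have "\<dots> \<le> \<kappa> powr (1 + i) * q powr (- 1 - i)" using ci by (intro mult_right_mono) auto
    also have "\<dots> = (q / \<kappa>) powr (- 1 - i)"
      using \<kappa> q by (simp add: powr_divide powr_diff powr_minus_divide powr_add)
    finally show False by simp
  qed
  show ?thesis
    unfolding Bad_fun_def Bad_def mem_Collect_eq prod.case
    by (rule exI[of _ c], intro conjI allI impI c(1) bad)
qed

section \<open>A uniform version of the Diophantine condition\<close>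

lemma dist_nearest_int_le: "dist_nearest_int t \<le> \<bar>t - of_int n\<bar>"
  unfolding dist_nearest_int_def using round_diff_minimal[of t n] by (simp add: abs_minus_commute)

lemma dist_nearest_int_nonneg: "0 \<le> dist_nearest_int t"
  by (simp add: dist_nearest_int_def)

lemma dist_nearest_int_mult_eq_0:
  assumes "dist_nearest_int t = 0"
  shows "dist_nearest_int (real n * t) = 0"
proof -
  have "t = of_int (round t)" using assms by (simp add: dist_nearest_int_def)
  then have "real n * t = of_int (int n * round t)" by simp
  then have "\<bar>real n * t - of_int (int n * round t)\<bar> = 0" by (simp only: diff_self abs_zero)
  then show ?thesis
    using dist_nearest_int_le[of "real n * t" "int n * round t"] dist_nearest_int_nonneg[of "real n * t"] by linarith
qed

text \<open>The liminf controls all large \<open>q\<close>, and the finitely many others contribute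
  a minimum. This minimum is positive because a common zero at \<open>q\<close> would recur at every
  multiple of \<open>q\<close>, among them large ones.\<close>

lemma uniform_lower_bound:
  fixes a b s :: real
  assumes "0 < liminf (\<lambda>q::nat. ereal (real q powr s *
     max (dist_nearest_int (real q * a)) (dist_nearest_int (real q * b))))"
  obtains c where "0 < c"
    "\<And>q::nat. 1 \<le> q \<Longrightarrow> c * real q powr - s \<le> max (dist_nearest_int (real q * a)) (dist_nearest_int (real q * b))"
proof -
  define M where "M = (\<lambda>q::nat. max (dist_nearest_int (real q * a)) (dist_nearest_int (real q * b)))"
  obtain c where c: "0 < ereal c" "ereal c < liminf (\<lambda>q::nat. ereal (real q powr s * M q))"
    using ereal_dense2[OF assms] unfolding M_def by blast
  from less_LiminfD[OF c(2)] obtain N where N: "\<And>q. N \<le> q \<Longrightarrow> c < real q powr s * M q"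
    unfolding eventually_sequentially by auto
  have pos: "0 < real q powr s * M q" if q: "1 \<le> q" for q
  proof (rule ccontr)
    assume "\<not> ?thesis"
    then have "M q \<le> 0" using q by (simp add: zero_less_mult_iff not_less)
    then have "dist_nearest_int (real q * a) = 0" "dist_nearest_int (real q * b) = 0"
      using dist_nearest_int_nonneg[of "real q * a"] dist_nearest_int_nonneg[of "real q * b"]
      unfolding M_def by linarith+
    then have "M (Suc N * q) = 0"
      using dist_nearest_int_mult_eq_0[of "real q * a" "Suc N"] dist_nearest_int_mult_eq_0[of "real q * b" "Suc N"]
      unfolding M_def by (simp only: of_nat_mult mult.assoc max.idem)
    moreover have "N \<le> Suc N * q" using mult_le_mono2[OF q, of "Suc N"] by simp
    ultimately show False using N[of "Suc N * q"] c(1) by simp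
  qed
  define c' where "c' = Min (insert c ((\<lambda>q. real q powr s * M q) ` {1..N}))"
  have "0 < c'" using pos c(1) unfolding c'_def by (subst Min_gr_iff) auto
  moreover have "c' * real q powr - s \<le> M q" if q: "1 \<le> q" for q
  proof -
    have "c' \<le> real q powr s * M q"
    proof (cases "q \<le> N")
      case True
      then show ?thesis unfolding c'_def using q by (intro Min_le) auto
    next
      case False
      have "c' \<le> c" unfolding c'_def by (intro Min_le) auto
      then show ?thesis using N[of q] False by linarith
    qed
    then show ?thesis using q by (simp add: powr_minus_divide divide_le_eq mult.commute)
  qed
  ultimately show ?thesis using that unfolding M_def by blast
qed

lemma dioph_int:
  fixes a b s s' c :: real and A B C :: int
  assumes lower: "\<And>q::nat. 1 \<le> q \<Longrightarrow> c * real q powr - s \<le> max (dist_nearest_int (real q * a)) (dist_nearest_int (real q * b))"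
    and "0 < c" "s \<le> s'" "B \<noteq> 0"
  shows "c * \<bar>of_int B\<bar> powr - s' \<le> max \<bar>of_int A + of_int B * a\<bar> \<bar>of_int C + of_int B * b\<bar>"
proof -
  define q where "q = nat \<bar>B\<bar>"
  have q: "1 \<le> q" "real q = \<bar>of_int B\<bar>" using \<open>B \<noteq> 0\<close> by (auto simp: q_def)
  have d: "dist_nearest_int (real q * t) \<le> \<bar>of_int n + of_int B * t\<bar>" for t n
  proof (cases "0 < B")
    case True
    then show ?thesis using dist_nearest_int_le[of "real q * t" "- n"] q(2) by (simp add: add.commute)
  next
    case False
    then show ?thesis using dist_nearest_int_le[of "real q * t" n] q(2)
      by (simp add: abs_minus_commute)
  qed
  have "real q powr - s' \<le> real q powr - s" using q(1) \<open>s \<le> s'\<close> by (intro powr_mono) auto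
  then have "c * \<bar>of_int B\<bar> powr - s' \<le> c * real q powr - s" using \<open>0 < c\<close> q(2) by simp
  also have "\<dots> \<le> max (dist_nearest_int (real q * a)) (dist_nearest_int (real q * b))"
    by (rule lower[OF q(1)])
  also have "\<dots> \<le> max \<bar>of_int A + of_int B * a\<bar> \<bar>of_int C + of_int B * b\<bar>"
    using d[of a A] d[of b C] by (intro max.mono)
  finally show ?thesis .
qed

section \<open>Choice of the parameters and conclusion\<close>

lemma small_parameter:
  fixes i j e c0 c1 t0 K K' E \<mu> :: real
  assumes "0 < i" "0 < j" "0 < e" "0 < c0" "0 < c1" "0 < t0" "0 < K" "0 < K'" "0 < E" "0 < \<mu>"
  obtains \<eta> where "0 < \<eta>" "\<eta> \<le> 1" "2 * \<eta> * K'\<^sup>2 \<le> 1" "2 * \<eta> * E\<^sup>2 * \<mu> \<le> 1"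
      "\<eta> * t0 powr - i < 1" "\<eta> * t0 powr - j < 1" "\<eta> * t0 powr - 1 < 1" "K * t0 * \<eta> \<le> 1" "\<eta> \<le> c0 / 2"
      "\<eta> powr e \<le> c1 * t0 powr (- 1 - i) * t0 powr e"
proof -
  define w where "w = c1 * t0 powr (- 1 - i) * t0 powr e"
  have w: "0 < w" using assms by (simp add: w_def)
  have small: "\<forall>\<^sub>F \<eta> in at_right 0. \<eta> * y < 1" if "0 < y" for y :: real
    unfolding eventually_at_right_field using that by (intro exI[of _ "1 / y"]) (auto simp: field_simps)
  have "\<forall>\<^sub>F \<eta> in at_right 0. 0 < (\<eta> :: real)" by (rule eventually_at_right_less)
  moreover have "\<forall>\<^sub>F \<eta> in at_right (0::real). \<eta> * 1 < 1 \<and> \<eta> * (2 * K'\<^sup>2) < 1 \<and> \<eta> * (2 * E\<^sup>2 * \<mu>) < 1 \<and>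
      \<eta> * t0 powr - i < 1 \<and> \<eta> * t0 powr - j < 1 \<and> \<eta> * t0 powr - 1 < 1 \<and> \<eta> * (K * t0) < 1 \<and> \<eta> * (2 / c0) < 1 \<and>
      \<eta> * (1 / w powr (1 / e)) < 1"
    using assms w by (intro eventually_conj small) auto
  ultimately have "\<forall>\<^sub>F \<eta> in at_right (0::real). 0 < \<eta> \<and> \<eta> * 1 < 1 \<and> \<eta> * (2 * K'\<^sup>2) < 1 \<and> \<eta> * (2 * E\<^sup>2 * \<mu>) < 1 \<and>
      \<eta> * t0 powr - i < 1 \<and> \<eta> * t0 powr - j < 1 \<and> \<eta> * t0 powr - 1 < 1 \<and> \<eta> * (K * t0) < 1 \<and> \<eta> * (2 / c0) < 1 \<and>
      \<eta> * (1 / w powr (1 / e)) < 1"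
    by (rule eventually_conj)
  then obtain \<eta> :: real where \<eta>: "0 < \<eta>" "\<eta> * 1 < 1" "\<eta> * (2 * K'\<^sup>2) < 1" "\<eta> * (2 * E\<^sup>2 * \<mu>) < 1"
      "\<eta> * t0 powr - i < 1" "\<eta> * t0 powr - j < 1" "\<eta> * t0 powr - 1 < 1" "\<eta> * (K * t0) < 1" "\<eta> * (2 / c0) < 1"
      "\<eta> * (1 / w powr (1 / e)) < 1"
    using eventually_happens'[OF trivial_limit_at_right_real] by blast
  have "\<eta> \<le> w powr (1 / e)" using \<eta>(10) w by (simp add: divide_less_eq)
  then have "\<eta> powr e \<le> (w powr (1 / e)) powr e" using \<eta>(1) assms by (intro powr_mono2) auto
  then have "\<eta> powr e \<le> w" using assms w by (simp add: powr_powr)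
  then show ?thesis using \<eta> assms that[of \<eta>] unfolding w_def by (simp add: mult_ac divide_less_eq)
qed

lemma exists_obstacle_classes:
  fixes i j a b \<gamma> \<delta> e c0 \<beta> :: real
  assumes ij: "0 < j" "j \<le> i" "i + j = 1" and e: "0 < e" "e \<le> i" "2 * e < 1" and c0: "0 < c0"
    and \<beta>: "0 < \<beta>" "\<beta> < 1"
    and dioph: "\<And>A B C :: int. B \<noteq> 0 \<Longrightarrow> c0 * \<bar>of_int B\<bar> powr (- ((1 - 2 * e) / j)) \<le>
        max \<bar>of_int A + of_int B * a\<bar> \<bar>of_int C + of_int B * b\<bar>"
    and J: "closed_interval J"
  shows "\<exists>P. \<forall>I x. I 0 = J \<and> avoiding \<beta> P I \<and> (\<forall>n. x \<in> I n) \<longrightarrow> x \<in> Bad_fun (\<lambda>x. a * x + b) (\<gamma>, \<delta>) i j"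
proof -
  obtain l u where lu: "l < u" "J = {l..u}" "measure lborel J = u - l"
    using closed_intervalE[OF J] by metis
  define r0 where "r0 = u - l"
  define x0 where "x0 = max \<bar>l\<bar> \<bar>u\<bar>"
  \<comment> \<open>One round, of two moves by each player, shrinks the interval by
    \<open>(\<beta> / 2)\<^sup>2 = 1 / R\<close>. The values of \<open>t0\<close> and
    \<open>S\<close> translate this into times, so that \<open>T n powr (- 1 - i)\<close> is the
    length of \<open>I n\<close>; \<open>G\<close> is the reciprocal of the distance constant
    \<open>\<beta> / 8\<close>.\<close>
  define t0 where "t0 = r0 powr (- 1 / (1 + i))"
  define R where "R = (2 / \<beta>)\<^sup>2"
  define S where "S = R powr (1 / (1 + i))"
  define G where "G = 8 / \<beta>"
  \<comment> \<open>Raising the class by one multiplies \<open>\<tau> powr e\<close> by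
    \<open>R\<close>, which pays for the one extra round of delay;
    \<open>K powr e = G * R ^ 12\<close> covers the delay common to all classes.\<close>
  define \<mu> where "\<mu> = R powr (1 / e)"
  define K where "K = (G * R ^ 12) powr (1 / e)"
  define K' where "K' = K * S"
  define E where "E = R + K' powr (1 + i)"
  define c1 where "c1 = min 1 (c0 / (2 * (1 + x0)))"
  define T where "T = (\<lambda>n::nat. t0 * S ^ n)"
  define D where "D = (\<lambda>k. E * (K * \<mu> ^ k) powr (e - 1))"
  define F where "F = (\<lambda>k. (K * \<mu> ^ Suc k) powr j)"
  have i: "0 < i" using ij by linarith
  have R: "1 < R" unfolding R_def using \<beta> by (intro one_less_power) (auto simp: less_divide_eq)
  have S: "1 < S" unfolding S_def using R i by simp
  have RS: "R = S powr (1 + i)" unfolding S_def using R i by (simp add: powr_powr)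
  have G: "1 \<le> G" unfolding G_def using \<beta> by (simp add: le_divide_eq)
  have r0: "0 < r0" using lu by (simp add: r0_def)
  have t0: "0 < t0" using r0 by (simp add: t0_def)
  have K: "0 < K" using G R by (simp add: K_def)
  have K': "0 < K'" using K S by (simp add: K'_def)
  have E: "0 < E" unfolding E_def using R by (intro add_pos_nonneg) auto
  have \<mu>: "0 < \<mu>" using R by (simp add: \<mu>_def)
  have c1: "0 < c1" using c0 by (simp add: c1_def x0_def add_pos_nonneg)
  obtain \<eta> where \<eta>: "0 < \<eta>" "\<eta> \<le> 1" "2 * \<eta> * K'\<^sup>2 \<le> 1" "2 * \<eta> * E\<^sup>2 * \<mu> \<le> 1"
      "\<eta> * t0 powr - i < 1" "\<eta> * t0 powr - j < 1" "\<eta> * t0 powr - 1 < 1" "K * t0 * \<eta> \<le> 1" "\<eta> \<le> c0 / 2"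
      "\<eta> powr e \<le> c1 * t0 powr (- 1 - i) * t0 powr e"
    using small_parameter[OF i ij(1) e(1) c0 c1 t0 K K' E \<mu>] by metis
  have T_powr: "T n powr (- 1 - i) = (\<beta> / 2) ^ (2 * n) * r0" for n
  proof -
    have "t0 powr (- 1 - i) = r0"
    proof -
      have "- 1 / (1 + i) * (- 1 - i) = 1" using i by (simp add: field_simps)
      then show ?thesis unfolding t0_def powr_powr using r0 by simp
    qed
    moreover have "(S ^ n) powr (- 1 - i) = (\<beta> / 2) ^ (2 * n)"
    proof -
      have "(S ^ n) powr (1 + i) = R ^ n"
        using S unfolding RS by (simp add: powr_realpow[symmetric] powr_powr mult.commute)
      moreover have "(S ^ n) powr (- 1 - i) = 1 / (S ^ n) powr (1 + i)"
        using powr_minus_divide[of "S ^ n" "1 + i"] by simp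
      moreover have "1 / R ^ n = (\<beta> / 2) ^ (2 * n)"
        by (simp add: R_def power_mult power_divide)
      ultimately show ?thesis by simp
    qed
    ultimately show ?thesis using t0 S by (simp add: T_def powr_mult)
  qed
  define P where "P = (\<lambda>m k. centre i j a b \<gamma> \<delta> \<eta> (\<eta> / (2 * K')) K' D F k (T m))"
  show ?thesis
  proof (intro exI[of _ P] allI impI, elim conjE)
    fix I :: "nat \<Rightarrow> real set" and x
    assume I0: "I 0 = J" and I: "avoiding \<beta> P I"
      and x: "\<forall>n. x \<in> I n"
    have mT: "measure lborel (I n) = T n powr (- 1 - i)" for n
      using avoidingD(3)[OF I] lu(3) T_powr by (simp add: r0_def I0)
    interpret nested_intervals i j a b \<gamma> \<delta> e c0 x0 t0 S G \<eta> R \<mu> K K' E c1 "\<eta> / (2 * K')" T D F I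
    proof
      show "\<bar>x\<bar> \<le> x0" if "x \<in> I 0" for x using that unfolding I0 lu x0_def by auto
      show "\<bar>x - y\<bar> \<le> T n powr (- 1 - i)" if "x \<in> I n" "y \<in> I n" for n x y
      proof -
        obtain l u where "I n = {l..u}" "measure lborel (I n) = u - l"
          using closed_intervalE[OF avoidingD(1)[OF I]] by metis
        then show ?thesis using that mT[of n] by auto
      qed
      show "T n powr (- 1 - i) \<le> G * \<bar>x - y\<bar>" if "y \<notin> I n" "x \<in> I (Suc n)" for n x y
      proof -
        have "\<beta> / 8 * T n powr (- 1 - i) \<le> \<bar>x - y\<bar>" using avoidingD(4)[OF I that] mT by simp
        then show ?thesis using \<beta> by (simp add: G_def field_simps)
      qed
      show "X \<notin> I (m + k + 9)" if "X \<in> I m"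
        "centre i j a b \<gamma> \<delta> \<eta> (\<eta> / (2 * K')) K' D F k (T m) X"
        "\<And>X'. X' \<in> I m \<Longrightarrow> centre i j a b \<gamma> \<delta> \<eta> (\<eta> / (2 * K')) K' D F k (T m) X' \<Longrightarrow> X' = X" for m k X
        using avoidingD(5)[OF I] that unfolding P_def by blast
      show "I (Suc n) \<subseteq> I n" for n using avoidingD(2)[OF I] .
      show "c0 * \<bar>of_int B\<bar> powr - ((1 - 2 * e) / j) \<le> max \<bar>of_int A + of_int B * a\<bar> \<bar>of_int C + of_int B * b\<bar>"
        if "B \<noteq> 0" for A B C :: int using dioph[OF that] .
    qed (fact ij i e c0 t0 S G RS \<mu>_def K_def K'_def E_def c1_def T_def D_def F_def \<eta> | simp add: x0_def)+
    show "x \<in> Bad_fun (\<lambda>x. a * x + b) (\<gamma>, \<delta>) i j"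
      by (rule in_Bad_fun[OF x[rule_format] assms(2)])
  qed
qed

theorem theorem7:
  fixes i j a b :: real and f :: "real \<Rightarrow> real"
  assumes "0 < j" and "j \<le> i" and "i < 1" and "i + j = 1"
    and "f = (\<lambda>x. a * x + b)"
    and "\<exists>\<epsilon>>0. liminf (\<lambda>q::nat. ereal (real q powr (1 / j - \<epsilon>) *
           max (dist_nearest_int (real q * a)) (dist_nearest_int (real q * b)))) > 0"
  shows "\<forall>\<gamma> \<delta>. schmidt_alpha_winning (1 / 2) (Bad_fun f (\<gamma>, \<delta>) i j)"
  unfolding schmidt_alpha_winning_def
proof (intro allI impI, elim conjE)
  fix \<gamma> \<delta> \<beta> :: real
  assume \<beta>: "0 < \<beta>" "\<beta> < 1"
  obtain \<epsilon> where \<epsilon>: "0 < \<epsilon>" "liminf (\<lambda>q::nat. ereal (real q powr (1 / j - \<epsilon>) *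
           max (dist_nearest_int (real q * a)) (dist_nearest_int (real q * b)))) > 0"
    using assms(6) by blast
  obtain c0 where c0: "0 < c0" "\<And>q::nat. 1 \<le> q \<Longrightarrow>
      c0 * real q powr - (1 / j - \<epsilon>) \<le> max (dist_nearest_int (real q * a)) (dist_nearest_int (real q * b))"
    using uniform_lower_bound[OF \<epsilon>(2)] by metis
  \<comment> \<open>The bound \<open>2 * e \<le> j * \<epsilon>\<close> gives
    \<open>1 / j - \<epsilon> \<le> (1 - 2 * e) / j\<close>. The cap \<open>1 / 4\<close> ensures
    \<open>2 * e < 1\<close>, and also \<open>e \<le> i\<close>, since
    \<open>i \<ge> 1 / 2\<close>.\<close>
  define e where "e = min (j * \<epsilon> / 2) (1 / 4)"
  have "0 < e" "e \<le> 1 / 4" using assms(1) \<epsilon>(1) by (auto simp: e_def)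
  then have e: "0 < e" "e \<le> i" "2 * e < 1" using assms(2,4) by linarith+
  have "1 - j * \<epsilon> \<le> 1 - 2 * e" by (auto simp: e_def)
  then have "(1 - j * \<epsilon>) / j \<le> (1 - 2 * e) / j" using assms(1) by (intro divide_right_mono) auto
  then have "1 / j - \<epsilon> \<le> (1 - 2 * e) / j" using assms(1) by (simp add: diff_divide_distrib)
  note dioph = dioph_int[OF c0(2) c0(1) this]
  show "schmidt_winning (1 / 2) \<beta> (Bad_fun f (\<gamma>, \<delta>) i j)"
    unfolding assms(5)
    by (rule winning_by_avoidance[OF \<beta> exists_obstacle_classes[OF assms(1,2,4) e c0(1) \<beta> dioph]])
qed

end
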